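(* If $\gamma>0$, then for any real constants $a=(a_e)_{e\in E}$ the random field $W(\sigma)=\sum_{e\in E}a_eg_ef_e(\sigma)$ satisfies $$\mathbb{E}\bigl(\langle W(\sigma)^2\rangle-\langle W(\sigma)\rangle^2\bigr)\leq\frac{\sqrt{2}}{\gamma}\|a\|_2\|a\|_1.$$
   Context: Let $(\Sigma,\mathcal{F})$ be a measurable space, $E$ a fixed finite index set, $(f_e)_{e\in E}$ a family of measurable functions $f_e:\Sigma\to[-1,1]$, and $(g_e)_{e\in E}$ i.i.d. standard Gaussian random variables. Let $$Y(\sigma)=\sum_{e\in E}g_ef_e(\sigma),\qquad dG(\sigma)=\frac{\exp(\gamma Y(\sigma))}{Z}\,d\mu(\sigma),$$ where $\gamma>0$ is a constant, $\mu$ is a (possibly random) finite nonzero measure on $(\Sigma,\mathcal{F})$, and $Z$ is the normalizing constant making the Gibbs measure $G$ a probability measure. The functions $f_e$ may also be random; all the randomness of $(f_e)_{e\in E}$ and $\mu$ is independent of $(g_e)_{e\in E}$. The bracket $\langle\,\cdot\,\rangle$ denotes the average with respect to $G$ (for fixed disorder, including the $g_e$), and $\mathbb{E}$ the expectation over all the disorder. Notation: $\|a\|_2=(\sum_{e\in E}a_e^2)^{1/2}$ and $\|a\|_1=\sum_{e\in E}|a_e|$. *)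

theory Defs
  imports "HOL-Probability.Probability"
begin

definition gauss_field :: "'e set \<Rightarrow> ('e \<Rightarrow> real) \<Rightarrow> ('e \<Rightarrow> 's \<Rightarrow> real) \<Rightarrow> 's \<Rightarrow> real" where
  "gauss_field E c h \<sigma> = (\<Sum>e\<in>E. c e * h e \<sigma>)"

definition partition_function :: "'s measure \<Rightarrow> ('s \<Rightarrow> real) \<Rightarrow> real" where
  "partition_function \<nu> H = (\<integral>\<sigma>. exp (H \<sigma>) \<partial>\<nu>)"

definition gibbs_measure :: "'s measure \<Rightarrow> ('s \<Rightarrow> real) \<Rightarrow> 's measure" where
  "gibbs_measure \<nu> H = density \<nu> (\<lambda>\<sigma>. ennreal (exp (H \<sigma>) / partition_function \<nu> H))"

text \<open>
  A random finite nonzero measure on the measurable space \<open>S\<close>, as a kernel from \<open>D\<close> to \<open>S\<close>.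
  The kernels of the library (\<open>subprob_algebra\<close>, \<open>prob_algebra\<close>) bound the total mass by 1,
  hence the explicit definition. Only \<open>space S\<close> and \<open>sets S\<close> matter; the measure that \<open>S\<close>
  carries as an element of its type is not used.
\<close>

definition finite_nonzero_kernel :: "'w measure \<Rightarrow> 's measure \<Rightarrow> ('w \<Rightarrow> 's measure) \<Rightarrow> bool" where
  "finite_nonzero_kernel D S \<mu> \<longleftrightarrow>
     (\<forall>\<omega>\<in>space D. sets (\<mu> \<omega>) = sets S \<and> finite_measure (\<mu> \<omega>) \<and> emeasure (\<mu> \<omega>) (space S) \<noteq> 0) \<and>
     (\<forall>A\<in>sets S. (\<lambda>\<omega>. emeasure (\<mu> \<omega>) A) \<in> borel_measurable D)"

text \<open>
  The disorder. The sub-\<open>\<sigma>\<close>-algebra \<open>D\<close> of \<open>M\<close> carries all the randomness of \<open>f\<close> and \<open>\<mu>\<close>.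
  Joint measurability of \<open>f e\<close> is with respect to \<open>D\<close>, and independence is required of \<open>D\<close> and
  the whole vector \<open>(g e)\<close>: independence of \<open>g\<close> from just the pointwise evaluations \<open>f e _ \<sigma>\<close>
  would be too weak, since these need not determine the averages of \<open>f e\<close> under \<open>\<mu>\<close>.
  Deterministic \<open>f\<close> and \<open>\<mu>\<close> are the case of the trivial \<open>\<sigma>\<close>-algebra.
\<close>

definition gibbs_disorder ::
  "'w measure \<Rightarrow> 'w measure \<Rightarrow> 's measure \<Rightarrow> 'e set \<Rightarrow>
   ('e \<Rightarrow> 'w \<Rightarrow> real) \<Rightarrow> ('e \<Rightarrow> 'w \<Rightarrow> 's \<Rightarrow> real) \<Rightarrow> ('w \<Rightarrow> 's measure) \<Rightarrow> bool" where
  "gibbs_disorder M D S E g f \<mu> \<longleftrightarrow>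
     prob_space M \<and> finite E \<and>
     prob_space.indep_vars M (\<lambda>_. borel) g E \<and>
     (\<forall>e\<in>E. distributed M lborel (g e) std_normal_density) \<and>
     subalgebra M D \<and>
     (\<forall>e\<in>E. (\<lambda>(\<omega>, \<sigma>). f e \<omega> \<sigma>) \<in> borel_measurable (D \<Otimes>\<^sub>M S)) \<and>
     (\<forall>e\<in>E. \<forall>\<omega>\<in>space M. \<forall>\<sigma>\<in>space S. f e \<omega> \<sigma> \<in> {-1..1}) \<and>
     finite_nonzero_kernel D S \<mu> \<and>
     prob_space.indep_set M (sets D)
       (sets (vimage_algebra (space M) (\<lambda>\<omega>. \<lambda>e\<in>E. g e \<omega>) (\<Pi>\<^sub>M e\<in>E. borel)))"

end

theory Submission
  imports Defs "HOL-Real_Asymp.Real_Asymp"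
begin

text \<open>
  Freeze the disorder of \<open>f\<close> and \<open>\<mu>\<close>. Differentiating the Gibbs averages in the Gaussian
  coordinate \<open>g\<^sub>e\<close> gives \<open>\<partial>\<^sub>e \<langle>W\<rangle> = a\<^sub>e \<langle>f\<^sub>e\<rangle> + \<gamma> (\<langle>f\<^sub>e W\<rangle> - \<langle>f\<^sub>e\<rangle>\<langle>W\<rangle>)\<close>, hence
  \<open>\<gamma> (\<langle>W\<^sup>2\<rangle> - \<langle>W\<rangle>\<^sup>2) = \<Sum>\<^sub>e a\<^sub>e g\<^sub>e (\<partial>\<^sub>e \<langle>W\<rangle> - a\<^sub>e \<langle>f\<^sub>e\<rangle>)\<close>.
  By Gaussian integration by parts, the expectation of \<open>g\<^sub>e \<partial>\<^sub>e \<langle>W\<rangle>\<close> is that of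
  \<open>(g\<^sub>e\<^sup>2 - 1) \<langle>W\<rangle>\<close>, while the expectation of \<open>g\<^sub>e \<langle>f\<^sub>e\<rangle>\<close> equals
  \<open>\<gamma>\<close> times that of \<open>\<langle>f\<^sub>e\<^sup>2\<rangle> - \<langle>f\<^sub>e\<rangle>\<^sup>2\<close> and may be dropped, being nonnegative. What remains is
  the expectation of \<open>Q \<langle>W\<rangle>\<close> with \<open>Q = \<Sum>\<^sub>e a\<^sub>e (g\<^sub>e\<^sup>2 - 1)\<close>; since \<open>|\<langle>f\<^sub>e\<rangle>| \<le> 1\<close> and \<open>Q\<close> has
  \<open>L\<^sup>2\<close>-norm \<open>\<surd>2 \<parallel>a\<parallel>\<^sub>2\<close>, the Cauchy--Schwarz inequality gives the bound.
\<close>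

subsection \<open>Gaussian integration by parts\<close>

abbreviation std_gauss :: "real measure" where
  "std_gauss \<equiv> density lborel (\<lambda>y. ennreal (std_normal_density y))"

abbreviation gauss_prod :: "'e set \<Rightarrow> ('e \<Rightarrow> real) measure" where
  "gauss_prod E \<equiv> \<Pi>\<^sub>M e\<in>E. std_gauss"

lemma prob_space_std_gauss: "prob_space std_gauss"
  by (rule prob_space_normal_density) simp

lemma integrable_std_gauss_iff:
  fixes f :: "real \<Rightarrow> real"
  assumes "f \<in> borel_measurable borel"
  shows "integrable std_gauss f \<longleftrightarrow> integrable lborel (\<lambda>y. std_normal_density y * f y)"
  using assms by (subst integrable_density) auto

lemma integral_std_gauss:
  fixes f :: "real \<Rightarrow> real"
  assumes "f \<in> borel_measurable borel"
  shows "(\<integral>y. f y \<partial>std_gauss) = (\<integral>y. std_normal_density y * f y \<partial>lborel)"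
  using assms by (subst integral_density) auto

lemma integrable_std_gauss_power: "integrable std_gauss (\<lambda>y. (1 + \<bar>y\<bar>) ^ k)"
proof -
  have "integrable std_gauss (\<lambda>y. \<bar>y\<bar> ^ i)" for i
    by (subst integrable_std_gauss_iff) (auto intro: integrable_std_normal_moment_abs)
  then have "integrable std_gauss (\<lambda>y. \<Sum>i\<le>k. of_nat (k choose i) * 1 ^ i * \<bar>y\<bar> ^ (k - i))"
    by (intro Bochner_Integration.integrable_sum integrable_mult_right) auto
  then show ?thesis
    by (simp add: binomial_ring)
qed

lemma integrable_std_gauss_growth:
  fixes f :: "real \<Rightarrow> real"
  assumes [measurable]: "f \<in> borel_measurable borel" and "\<And>y. \<bar>f y\<bar> \<le> C * (1 + \<bar>y\<bar>) ^ k"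
  shows "integrable std_gauss f"
proof (rule Bochner_Integration.integrable_bound)
  show "integrable std_gauss (\<lambda>y. C * (1 + \<bar>y\<bar>) ^ k)"
    by (intro integrable_mult_right integrable_std_gauss_power)
  show "AE y in std_gauss. norm (f y) \<le> norm (C * (1 + \<bar>y\<bar>) ^ k)"
    using assms(2) by (auto intro!: AE_I2 order_trans[OF assms(2)])
qed simp

text \<open>The integrand times the standard normal density is the derivative of minus the density
  times \<open>u\<close>, and the growth bound on \<open>u\<close> makes this primitive vanish at
  both infinities. Quadratic growth covers the later uses, where one factor comes from an explicit
  coordinate and one from the field.\<close>

lemma gaussian_integration_by_parts:
  fixes u u' :: "real \<Rightarrow> real"
  assumes u: "\<And>y. (u has_real_derivative u' y) (at y)"
    and cont: "\<And>y. isCont u' y"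
    and bu: "\<And>y. \<bar>u y\<bar> \<le> C * (1 + \<bar>y\<bar>) ^ 2"
    and bu': "\<And>y. \<bar>u' y\<bar> \<le> C' * (1 + \<bar>y\<bar>) ^ 2"
  shows "(\<integral>y. (y * u y - u' y) \<partial>std_gauss) = 0"
proof -
  let ?\<phi> = std_normal_density
  let ?F = "\<lambda>y. - ?\<phi> y * u y"
  let ?f = "\<lambda>y. ?\<phi> y * (y * u y - u' y)"
  have cu: "isCont u y" for y
    using u by (rule DERIV_isCont)
  have [measurable]: "u \<in> borel_measurable borel" "u' \<in> borel_measurable borel"
    using cu cont by (auto intro!: borel_measurable_continuous_onI continuous_at_imp_continuous_on)
  have C: "C \<ge> 0" "C' \<ge> 0"
    using bu[of 0] bu'[of 0] by auto
  have "\<bar>y * u y - u' y\<bar> \<le> (C + C') * (1 + \<bar>y\<bar>) ^ 3" for y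
  proof -
    have "\<bar>y * u y - u' y\<bar> \<le> \<bar>y\<bar> * \<bar>u y\<bar> + \<bar>u' y\<bar>"
      by (metis abs_mult abs_triangle_ineq4)
    also have "\<dots> \<le> (1 + \<bar>y\<bar>) * (C * (1 + \<bar>y\<bar>) ^ 2) + (1 + \<bar>y\<bar>) * (C' * (1 + \<bar>y\<bar>) ^ 2)"
      using C mult_mono[OF _ bu'[of y], of 1 "1 + \<bar>y\<bar>"] by (intro add_mono mult_mono bu) auto
    finally show ?thesis
      by (simp add: power3_eq_cube power2_eq_square algebra_simps)
  qed
  then have int: "integrable std_gauss (\<lambda>y. y * u y - u' y)"
    by (rule integrable_std_gauss_growth[rotated]) simp
  have lim: "(?F \<longlongrightarrow> 0) F" if *: "((\<lambda>y. C * (1 + \<bar>y\<bar>) ^ 2 * ?\<phi> y) \<longlongrightarrow> 0) F" for F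
  proof (rule Lim_null_comparison[OF _ *])
    show "\<forall>\<^sub>F y in F. norm (?F y) \<le> C * (1 + \<bar>y\<bar>) ^ 2 * ?\<phi> y"
      using mult_right_mono[OF bu normal_density_nonneg] by (simp add: abs_mult mult_ac)
  qed
  have top: "((\<lambda>y. C * (1 + \<bar>y\<bar>) ^ 2 * ?\<phi> y) \<longlongrightarrow> 0) at_top"
    unfolding std_normal_density_def by real_asymp
  have bot: "((\<lambda>y. C * (1 + \<bar>y\<bar>) ^ 2 * ?\<phi> y) \<longlongrightarrow> 0) at_bot"
    unfolding std_normal_density_def by real_asymp
  have dphi: "(?\<phi> has_real_derivative - y * ?\<phi> y) (at y)" for y
  proof -
    have "((\<lambda>y. exp (- y\<^sup>2 / 2)) has_real_derivative - y * exp (- y\<^sup>2 / 2)) (at y)"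
      by (auto intro!: derivative_eq_intros)
    from DERIV_cmult[OF this, of "1 / sqrt (2 * pi)"] show ?thesis
      unfolding std_normal_density_def by (rule DERIV_cong) simp
  qed
  \<comment> \<open>The fundamental theorem of calculus on the whole line; the two zeros are the
    limits of \<open>?F\<close> at the ends.\<close>
  have "(LBINT y=-\<infinity>..\<infinity>. ?f y) = 0 - 0"
  proof (rule interval_integral_FTC_integrable)
    show "(?F has_vector_derivative ?f y) (at y)" for y
      unfolding has_real_derivative_iff_has_vector_derivative[symmetric]
      by (auto intro!: derivative_eq_intros u dphi simp: algebra_simps)
    show "isCont ?f y" for y
      unfolding std_normal_density_def by (intro continuous_intros cu cont) auto
    show "set_integrable lborel (einterval (-\<infinity>) \<infinity>) ?f"
      using int by (simp add: set_integrable_def integrable_std_gauss_iff)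
    show "((?F \<circ> real_of_ereal) \<longlongrightarrow> 0) (at_right (-\<infinity>))"
      using lim[OF bot] by (simp add: ereal_tendsto_simps)
    show "((?F \<circ> real_of_ereal) \<longlongrightarrow> 0) (at_left \<infinity>)"
      using lim[OF top] by (simp add: ereal_tendsto_simps)
  qed simp
  then show ?thesis
    by (simp add: integral_std_gauss interval_lebesgue_integral_def set_lebesgue_integral_def)
qed

text \<open>The last value is 3 - 2 + 1, from the fourth and second moments. This 2 is the source of
  the factor \<open>sqrt 2\<close> in the theorem.\<close>

lemma std_gauss_moments:
  "(\<integral>y. y\<^sup>2 \<partial>std_gauss) = 1"
  "(\<integral>y. y\<^sup>2 - 1 \<partial>std_gauss) = 0"
  "(\<integral>y. (y\<^sup>2 - 1)\<^sup>2 \<partial>std_gauss) = 2"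
proof -
  interpret prob_space std_gauss by (rule prob_space_std_gauss)
  have [simp]: "prob UNIV = 1"
    using prob_space by simp
  have i: "integrable std_gauss (\<lambda>y. y ^ k)" for k
    by (rule integrable_std_gauss_growth[of _ 1 k]) (auto simp: power_abs intro!: power_mono)
  have m: "(\<integral>y. y ^ (2 * k) \<partial>std_gauss) = fact (2 * k) / (2 ^ k * fact k)" for k
    by (subst integral_std_gauss) (auto simp: integral_std_normal_moment_even)
  show 2: "(\<integral>y. y\<^sup>2 \<partial>std_gauss) = 1"
    using m[of 1] by (simp add: fact_numeral)
  show "(\<integral>y. y\<^sup>2 - 1 \<partial>std_gauss) = 0"
    using i[of 2] 2 by (simp add: prob_space)
  have 4: "(\<integral>y. y ^ 4 \<partial>std_gauss) = 3"
    using m[of 2] by (simp add: fact_numeral)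
  have "(\<integral>y. (y\<^sup>2 - 1)\<^sup>2 \<partial>std_gauss) = (\<integral>y. y ^ 4 - 2 * y\<^sup>2 + 1 \<partial>std_gauss)"
    by (intro Bochner_Integration.integral_cong) (auto simp: power2_eq_square power4_eq_xxxx algebra_simps)
  also have "\<dots> = 2"
    using i[of 2] i[of 4] 2 4 by (simp add: prob_space)
  finally show "(\<integral>y. (y\<^sup>2 - 1)\<^sup>2 \<partial>std_gauss) = 2" .
qed

section \<open>Product Gaussian measures: growth bounds, Fubini and moments\<close>

lemma finite_product_prob_space_gauss:
  assumes "finite E"
  shows "finite_product_prob_space (\<lambda>_. std_gauss) E"
proof -
  interpret prob_space std_gauss by (rule prob_space_std_gauss)
  show ?thesis by unfold_locales (use assms in auto)
qed

lemma sets_gauss_prod [measurable_cong]: "sets (gauss_prod E) = sets (\<Pi>\<^sub>M e\<in>E. borel)"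
  by (intro sets_PiM_cong) auto

text \<open>
  A growth bound that, unlike a norm of \<open>x\<close>, factorises over the coordinates: its powers are
  integrable by Fubini, and fixing all coordinates but one leaves a multiple of \<open>1 + |y|\<close>.
\<close>

definition weight :: "'e set \<Rightarrow> ('e \<Rightarrow> real) \<Rightarrow> real" where
  "weight E x = (\<Prod>e\<in>E. 1 + \<bar>x e\<bar>)"

lemma weight_ge_1: "1 \<le> weight E x"
  unfolding weight_def by (rule prod_ge_1) simp

lemma weight_update:
  assumes "finite E" "e \<in> E"
  shows "weight E (x(e := y)) = weight (E - {e}) x * (1 + \<bar>y\<bar>)"
  using assms by (simp add: weight_def prod.remove[of E e])

text \<open>The factor of the weight at \<open>e\<close> dominates the coordinate, and the remaining
  factors are at least 1.\<close>

lemma abs_le_weight: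
  assumes "finite E" "e \<in> E"
  shows "\<bar>x e\<bar> \<le> weight E x"
proof -
  have "1 * \<bar>x e\<bar> \<le> weight (E - {e}) x * (1 + \<bar>x e\<bar>)"
    by (intro mult_mono weight_ge_1) (auto intro: order_trans[OF _ weight_ge_1])
  then show ?thesis
    using weight_update[OF assms, of x "x e"] by simp
qed

lemma abs_square_diff_1_le_weight:
  assumes "finite E" "e \<in> E"
  shows "\<bar>(x e)\<^sup>2 - 1\<bar> \<le> weight E x ^ 2"
proof -
  have "(x e)\<^sup>2 \<le> weight E x ^ 2"
    using power_mono[OF abs_le_weight[OF assms, of x], of 2] by simp
  moreover have "1 \<le> weight E x ^ 2"
    by (intro one_le_power weight_ge_1)
  ultimately show ?thesis
    using zero_le_power2[of "x e"] by (simp only: abs_le_iff) linarith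
qed

lemma integrable_gauss_prod_growth:
  fixes f :: "('e \<Rightarrow> real) \<Rightarrow> real"
  assumes "finite E" and f: "f \<in> borel_measurable (\<Pi>\<^sub>M e\<in>E. borel)"
    and bound: "\<And>x. \<bar>f x\<bar> \<le> C * weight E x ^ k"
  shows "integrable (gauss_prod E) f"
proof (rule Bochner_Integration.integrable_bound)
  interpret finite_product_prob_space "\<lambda>_. std_gauss" E
    using assms(1) by (rule finite_product_prob_space_gauss)
  have "integrable (gauss_prod E) (\<lambda>x. \<Prod>e\<in>E. (1 + \<bar>x e\<bar>) ^ k)"
    by (intro product_integrable_prod integrable_std_gauss_power assms)
  then show "integrable (gauss_prod E) (\<lambda>x. C * weight E x ^ k)"
    by (simp add: weight_def prod_power_distrib)
  show "f \<in> borel_measurable (gauss_prod E)"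
    using f by (simp cong: measurable_cong_sets add: sets_gauss_prod)
  show "AE y in gauss_prod E. norm (f y) \<le> norm (C * weight E y ^ k)"
    using bound by (auto intro!: AE_I2 order_trans[OF bound])
qed

text \<open>Fubini with the chosen coordinate innermost: one-dimensional integration by parts then
  applies while all other coordinates are frozen.\<close>

lemma integral_gauss_prod_coordinate:
  fixes f :: "('e \<Rightarrow> real) \<Rightarrow> real"
  assumes "finite E" "e \<in> E" "integrable (gauss_prod E) f"
  shows "integral\<^sup>L (gauss_prod E) f =
    (\<integral>x. (\<integral>y. f (x(e := y)) \<partial>std_gauss) \<partial>gauss_prod (E - {e}))"
proof -
  interpret finite_product_prob_space "\<lambda>_. std_gauss" E
    using assms(1) by (rule finite_product_prob_space_gauss)
  show ?thesis
    using product_integral_insert[of "E - {e}" e f] assms by (simp add: insert_absorb)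
qed

lemma integral_gauss_prod_component:
  fixes h :: "real \<Rightarrow> real"
  assumes "finite E" "e \<in> E" "integrable (gauss_prod E) (\<lambda>x. h (x e))"
  shows "(\<integral>x. h (x e) \<partial>gauss_prod E) = (\<integral>y. h y \<partial>std_gauss)"
proof -
  interpret finite_product_prob_space "\<lambda>_. std_gauss" "E - {e}"
    using assms(1) by (intro finite_product_prob_space_gauss) simp
  show ?thesis
    using P.prob_space by (simp add: integral_gauss_prod_coordinate[OF assms])
qed

text \<open>The centred squares of the coordinates are orthogonal in the Gaussian space, each with
  squared norm 2, so only the diagonal of the expanded square survives.\<close>

lemma integral_gauss_prod_square:
  assumes "finite E"
  shows "integrable (gauss_prod E) (\<lambda>x. (\<Sum>e\<in>E. a e * ((x e)\<^sup>2 - 1))\<^sup>2)"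
    and "(\<integral>x. (\<Sum>e\<in>E. a e * ((x e)\<^sup>2 - 1))\<^sup>2 \<partial>gauss_prod E) = 2 * (L2_set a E)\<^sup>2"
proof -
  let ?q = "\<lambda>e x. (x e)\<^sup>2 - 1 :: real"
  have q: "\<bar>?q e x\<bar> \<le> weight E x ^ 2" if "e \<in> E" for e and x :: "'a \<Rightarrow> real"
    by (rule abs_square_diff_1_le_weight[OF assms that])
  have int: "integrable (gauss_prod E) (\<lambda>x. ?q e x * ?q e' x)" if "e \<in> E" "e' \<in> E" for e e'
  proof (rule integrable_gauss_prod_growth[OF assms, of _ 1 4])
    show "\<bar>?q e x * ?q e' x\<bar> \<le> 1 * weight E x ^ 4" for x
      using mult_mono[OF q[OF that(1), of x] q[OF that(2), of x]]
      by (simp add: abs_mult flip: power_add)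
    show "(\<lambda>x. ?q e x * ?q e' x) \<in> borel_measurable (\<Pi>\<^sub>M e\<in>E. borel)"
      using that by measurable
  qed
  have val: "(\<integral>x. ?q e x * ?q e' x \<partial>gauss_prod E) = (if e = e' then 2 else 0)"
    if "e \<in> E" "e' \<in> E" for e e'
  proof (cases "e = e'")
    case True
    then show ?thesis
      using integral_gauss_prod_component[OF assms that(1), of "\<lambda>y. (y\<^sup>2 - 1)\<^sup>2"] int[OF that]
      by (simp add: std_gauss_moments flip: power2_eq_square)
  next
    \<comment> \<open>The factor for \<open>e'\<close> is constant in the coordinate
      \<open>e\<close>, so the inner integral is a multiple of the mean of
      \<open>y\<^sup>2 - 1\<close>, which is zero.\<close>
    case False
    then show ?thesis
      using integral_gauss_prod_coordinate[OF assms that(1) int[OF that]]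
      by (simp add: std_gauss_moments)
  qed
  have sq: "(\<Sum>e\<in>E. a e * ?q e x)\<^sup>2 = (\<Sum>e\<in>E. \<Sum>e'\<in>E. a e * a e' * (?q e x * ?q e' x))" for x
    by (simp add: power2_eq_square sum_product algebra_simps)
  show "integrable (gauss_prod E) (\<lambda>x. (\<Sum>e\<in>E. a e * ?q e x)\<^sup>2)"
    unfolding sq by (intro Bochner_Integration.integrable_sum integrable_mult_right int)
  have "(\<integral>x. (\<Sum>e\<in>E. a e * ?q e x)\<^sup>2 \<partial>gauss_prod E)
      = (\<Sum>e\<in>E. \<Sum>e'\<in>E. a e * a e' * (\<integral>x. ?q e x * ?q e' x \<partial>gauss_prod E))"
    unfolding sq by (simp add: int)
  also have "\<dots> = (\<Sum>e\<in>E. \<Sum>e'\<in>E. if e = e' then 2 * (a e)\<^sup>2 else 0)"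
    by (intro sum.cong refl) (simp only: val, simp add: power2_eq_square)
  also have "\<dots> = 2 * (L2_set a E)\<^sup>2"
    using assms by (simp add: L2_set_def sum_nonneg sum_distrib_left)
  finally show "(\<integral>x. (\<Sum>e\<in>E. a e * ?q e x)\<^sup>2 \<partial>gauss_prod E) = 2 * (L2_set a E)\<^sup>2" .
qed

section \<open>The variance bound for abstract averages and covariances\<close>

text \<open>Here \<open>A e\<close> stands for the Gibbs average of the function with index
  \<open>e\<close> and \<open>B e e'\<close> for a Gibbs covariance. The Gibbs structure enters
  through the derivative relation \<open>dA\<close> and the nonnegative diagonal \<open>pos\<close>;
  the bound 2 on \<open>B\<close> serves integrability and growth estimates and leaves no trace in
  the final constant.\<close>

lemma gaussian_covariance_bound:
  fixes A :: "'e \<Rightarrow> ('e \<Rightarrow> real) \<Rightarrow> real" and B :: "'e \<Rightarrow> 'e \<Rightarrow> ('e \<Rightarrow> real) \<Rightarrow> real"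
  assumes E: "finite E" and gamma: "\<gamma> > 0"
    and mA [measurable]: "\<And>e. e \<in> E \<Longrightarrow> A e \<in> borel_measurable (\<Pi>\<^sub>M e\<in>E. borel)"
    and mB [measurable]: "\<And>e e'. e \<in> E \<Longrightarrow> e' \<in> E \<Longrightarrow> B e e' \<in> borel_measurable (\<Pi>\<^sub>M e\<in>E. borel)"
    and bA: "\<And>e x. e \<in> E \<Longrightarrow> \<bar>A e x\<bar> \<le> 1"
    and bB: "\<And>e e' x. e \<in> E \<Longrightarrow> e' \<in> E \<Longrightarrow> \<bar>B e e' x\<bar> \<le> 2"
    and pos: "\<And>e x. e \<in> E \<Longrightarrow> 0 \<le> B e e x"
    and dA: "\<And>e e' x y. e \<in> E \<Longrightarrow> e' \<in> E \<Longrightarrow>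
      ((\<lambda>y. A e' (x(e := y))) has_real_derivative \<gamma> * B e e' (x(e := y))) (at y)"
    and cB: "\<And>e e' x y. e \<in> E \<Longrightarrow> e' \<in> E \<Longrightarrow> isCont (\<lambda>y. B e e' (x(e := y))) y"
  shows "(\<integral>x. (\<Sum>e\<in>E. \<Sum>e'\<in>E. a e * a e' * x e * x e' * B e e' x) \<partial>gauss_prod E)
    \<le> sqrt 2 / \<gamma> * L2_set a E * (\<Sum>e\<in>E. \<bar>a e\<bar>)"
proof -
  define K where "K = (\<Sum>e\<in>E. \<bar>a e\<bar>)"
  \<comment> \<open>In the Gibbs reading, \<open>W\<close> is the average of the random field and
    \<open>C e\<close> is the covariance of the function with index \<open>e\<close> and that field,
    so the integrand to be bounded is the sum of \<open>a e * x e * C e x\<close>.\<close>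
  define Q where "Q x = (\<Sum>e\<in>E. a e * ((x e)\<^sup>2 - 1))" for x
  define W where "W x = (\<Sum>e\<in>E. a e * x e * A e x)" for x
  define C where "C e x = (\<Sum>e'\<in>E. a e' * x e' * B e e' x)" for e x
  have K: "0 \<le> K"
    by (simp add: K_def sum_nonneg)
  have mW [measurable]: "W \<in> borel_measurable (\<Pi>\<^sub>M e\<in>E. borel)"
    unfolding W_def by measurable
  have mC [measurable]: "C e \<in> borel_measurable (\<Pi>\<^sub>M e\<in>E. borel)" if "e \<in> E" for e
    unfolding C_def using that by measurable
  have w0: "0 \<le> weight E x" for x :: "'e \<Rightarrow> real"
    using weight_ge_1[of E x] by linarith
  have bW: "\<bar>W x\<bar> \<le> K * weight E x" for x
  proof -
    have "\<bar>W x\<bar> \<le> (\<Sum>e\<in>E. \<bar>a e\<bar> * weight E x * 1)"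
      unfolding W_def
      by (intro order_trans[OF sum_abs] sum_mono) (simp only: abs_mult, intro mult_mono, auto simp: w0 abs_le_weight bA E)
    then show ?thesis
      by (simp add: K_def sum_distrib_right)
  qed
  have bC: "\<bar>C e x\<bar> \<le> 2 * K * weight E x" if "e \<in> E" for e x
  proof -
    have "\<bar>C e x\<bar> \<le> (\<Sum>e\<in>E. \<bar>a e\<bar> * weight E x * 2)"
      unfolding C_def using that
      by (intro order_trans[OF sum_abs] sum_mono) (simp only: abs_mult, intro mult_mono, auto simp: w0 abs_le_weight bB E)
    then show ?thesis
      by (simp add: K_def sum_distrib_right sum_distrib_left mult_ac)
  qed
  have bq: "\<bar>(x e)\<^sup>2 - 1\<bar> \<le> weight E x ^ 2" if "e \<in> E" for e and x :: "'e \<Rightarrow> real"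
    by (rule abs_square_diff_1_le_weight[OF E that])
  have I1: "integrable (gauss_prod E) (\<lambda>x. ((x e)\<^sup>2 - 1) * W x)" if "e \<in> E" for e
  proof (rule integrable_gauss_prod_growth[OF E, of _ K 3])
    show "\<bar>((x e)\<^sup>2 - 1) * W x\<bar> \<le> K * weight E x ^ 3" for x
      using mult_mono[OF bq[OF that, of x] bW[of x]] w0[of x]
      by (simp add: abs_mult power2_eq_square power3_eq_cube mult_ac)
  qed (use that in measurable)
  have I2: "integrable (gauss_prod E) (\<lambda>x. x e * A e x)" if "e \<in> E" for e
  proof (rule integrable_gauss_prod_growth[OF E, of _ 1 1])
    show "\<bar>x e * A e x\<bar> \<le> 1 * weight E x ^ 1" for x
      using mult_mono[OF abs_le_weight[OF E that, of x] bA[OF that, of x]] w0[of x]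
      by (simp add: abs_mult)
  qed (use that in measurable)
  have I3: "integrable (gauss_prod E) (\<lambda>x. x e * C e x)" if "e \<in> E" for e
  proof (rule integrable_gauss_prod_growth[OF E, of _ "2 * K" 2])
    show "\<bar>x e * C e x\<bar> \<le> 2 * K * weight E x ^ 2" for x
      using mult_mono[OF abs_le_weight[OF E that, of x] bC[OF that, of x]] w0[of x]
      by (simp add: abs_mult power2_eq_square mult_ac)
  qed (use that in measurable)
  have I4: "integrable (gauss_prod E) (B e e)" if "e \<in> E" for e
    by (rule integrable_gauss_prod_growth[OF E, of _ 2 0]) (use that bB in auto)
  \<comment> \<open>The coordinate \<open>e\<close> occurs explicitly in one summand, which gives
    the term with \<open>A e\<close>, and inside the Gibbs weights of all summands, which together
    give the term with \<open>C e\<close>.\<close>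
  have dW: "((\<lambda>y. W (x(e := y))) has_real_derivative
      a e * A e (x(e := y)) + \<gamma> * C e (x(e := y))) (at y)" if e: "e \<in> E" for e x y
  proof -
    have "((\<lambda>y. W (x(e := y))) has_real_derivative
      (\<Sum>e'\<in>E. (if e' = e then a e' * A e' (x(e := y)) else 0)
          + \<gamma> * (a e' * (x(e := y)) e' * B e e' (x(e := y))))) (at y)"
      unfolding W_def
    proof (rule DERIV_sum)
      fix e' assume e': "e' \<in> E"
      have "((\<lambda>y. (x(e := y)) e') has_real_derivative (if e' = e then 1 else 0)) (at y)"
        by (auto intro!: derivative_eq_intros)
      then have "((\<lambda>y. a e' * (x(e := y)) e') has_real_derivative a e' * (if e' = e then 1 else 0)) (at y)"
        by (rule DERIV_cmult)
      from DERIV_mult[OF this dA[OF e e']]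
      show "((\<lambda>y. a e' * (x(e := y)) e' * A e' (x(e := y))) has_real_derivative
        (if e' = e then a e' * A e' (x(e := y)) else 0)
          + \<gamma> * (a e' * (x(e := y)) e' * B e e' (x(e := y)))) (at y)"
        by (rule DERIV_cong) (auto simp: algebra_simps)
    qed
    then show ?thesis
      by (rule DERIV_cong) (use E e in \<open>simp add: sum.distrib C_def sum_distrib_left\<close>)
  qed
  have cA: "isCont (\<lambda>y. A e' (x(e := y))) y" if "e \<in> E" "e' \<in> E" for e e' x y
    using dA[OF that] by (rule DERIV_isCont)
  have cC: "isCont (\<lambda>y. C e (x(e := y))) y" if "e \<in> E" for e x y
    unfolding C_def
  proof (rule continuous_sum)
    fix e' assume e': "e' \<in> E"
    have "isCont (\<lambda>y. (x(e := y)) e') y"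
      by (cases "e' = e") auto
    then show "isCont (\<lambda>y. a e' * (x(e := y)) e' * B e e' (x(e := y))) y"
      by (intro continuous_intros cB that e')
  qed
  have cW: "isCont (\<lambda>y. W (x(e := y))) y" if "e \<in> E" for e x y
    using dW[OF that] by (rule DERIV_isCont)
  \<comment> \<open>Integration by parts in the coordinate \<open>e\<close>, applied to
    \<open>a e * y * W\<close>. The extra factor \<open>y\<close> in this choice is what produces
    the centred square, and the product rule produces the other two terms.\<close>
  have parts1: "(\<integral>x. a e * (((x e)\<^sup>2 - 1) * W x) - (a e)\<^sup>2 * (x e * A e x) - \<gamma> * a e * (x e * C e x) \<partial>gauss_prod E) = 0"
    (is "integral\<^sup>L _ ?F = 0") if e: "e \<in> E" for e
  proof -
    have int: "integrable (gauss_prod E) ?F"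
      by (intro Bochner_Integration.integrable_diff integrable_mult_right I1 I2 I3 e)
    have "(\<integral>y. ?F (x(e := y)) \<partial>std_gauss) = 0" for x
    proof -
      let ?x = "\<lambda>y. x(e := y)"
      define w where "w = weight (E - {e}) x"
      have w: "0 \<le> w"
        unfolding w_def using weight_ge_1[of "E - {e}" x] by linarith
      have wx: "weight E (?x y) = w * (1 + \<bar>y\<bar>)" for y
        unfolding w_def by (rule weight_update[OF E e])
      define u where "u y = a e * y * W (?x y)" for y
      define u' where "u' y = a e * W (?x y) + a e * y * (a e * A e (?x y) + \<gamma> * C e (?x y))" for y
      have "(\<integral>y. y * u y - u' y \<partial>std_gauss) = 0"
      proof (rule gaussian_integration_by_parts)
        show "(u has_real_derivative u' y) (at y)" for y
          unfolding u_def u'_def using dW[OF e]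
          by (auto intro!: derivative_eq_intros)
        show "isCont u' y" for y
          unfolding u'_def by (intro continuous_intros cA cC cW e)
        show "\<bar>u y\<bar> \<le> (\<bar>a e\<bar> * K * w) * (1 + \<bar>y\<bar>) ^ 2" for y
        proof -
          have "\<bar>u y\<bar> \<le> \<bar>a e\<bar> * (1 + \<bar>y\<bar>) * (K * (w * (1 + \<bar>y\<bar>)))"
            unfolding u_def abs_mult using bW[of "?x y"]
            by (intro mult_mono) (auto simp: wx)
          then show ?thesis
            by (simp add: power2_eq_square mult_ac)
        qed
        show "\<bar>u' y\<bar> \<le> (\<bar>a e\<bar> * K * w + \<bar>a e\<bar> * (\<bar>a e\<bar> + \<gamma> * (2 * K * w))) * (1 + \<bar>y\<bar>) ^ 2" for y
        proof -
          let ?t = "1 + \<bar>y\<bar>"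
          have eq: "\<bar>a e\<bar> * (K * w * t * t) + \<bar>a e\<bar> * t * ((\<bar>a e\<bar> + \<gamma> * (2 * K * w)) * t)
            = (\<bar>a e\<bar> * K * w + \<bar>a e\<bar> * (\<bar>a e\<bar> + \<gamma> * (2 * K * w))) * t ^ 2" for t
            by (simp add: power2_eq_square algebra_simps)
          \<comment> \<open>The second factor \<open>?t\<close> is at least 1; it brings the linear
            bound to the quadratic growth shared by both terms of \<open>u'\<close>.\<close>
          have 1: "\<bar>W (?x y)\<bar> \<le> K * w * ?t * ?t"
          proof -
            have "\<bar>W (?x y)\<bar> \<le> K * w * ?t"
              using bW[of "?x y"] by (simp add: wx mult_ac)
            also have "\<dots> \<le> K * w * ?t * ?t"
              using mult_left_mono[of 1 ?t "K * w * ?t"] K w by simp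
            finally show ?thesis .
          qed
          have "\<bar>a e * A e (?x y) + \<gamma> * C e (?x y)\<bar> \<le> \<bar>a e\<bar> * 1 + \<gamma> * (2 * K * (w * ?t))"
            using bC[OF e, of "?x y"] bA[OF e, of "?x y"] gamma
            by (intro order_trans[OF abs_triangle_ineq] add_mono)
              (auto simp: abs_mult wx intro!: mult_left_mono mult_left_le)
          also have "\<dots> \<le> (\<bar>a e\<bar> + \<gamma> * (2 * K * w)) * ?t"
            by (simp add: algebra_simps)
          finally have 2: "\<bar>a e * A e (?x y) + \<gamma> * C e (?x y)\<bar> \<le> (\<bar>a e\<bar> + \<gamma> * (2 * K * w)) * ?t" .
          have "\<bar>u' y\<bar> \<le> \<bar>a e\<bar> * \<bar>W (?x y)\<bar> + \<bar>a e\<bar> * \<bar>y\<bar> * \<bar>a e * A e (?x y) + \<gamma> * C e (?x y)\<bar>"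
            unfolding u'_def by (rule order_trans[OF abs_triangle_ineq]) (simp add: abs_mult)
          also have "\<dots> \<le> \<bar>a e\<bar> * (K * w * ?t * ?t) + \<bar>a e\<bar> * ?t * ((\<bar>a e\<bar> + \<gamma> * (2 * K * w)) * ?t)"
            using 1 2 by (intro add_mono mult_mono) auto
          also have "\<dots> = (\<bar>a e\<bar> * K * w + \<bar>a e\<bar> * (\<bar>a e\<bar> + \<gamma> * (2 * K * w))) * ?t ^ 2"
            by (rule eq)
          finally show ?thesis .
        qed
      qed
      moreover have "?F (?x y) = y * u y - u' y" for y
        unfolding u_def u'_def by (simp add: algebra_simps power2_eq_square)
      ultimately show ?thesis
        by simp
    qed
    then show ?thesis
      using integral_gauss_prod_coordinate[OF E e int] by simp
  qed
  \<comment> \<open>Integration by parts applied to \<open>A e\<close> itself: it turns the mean of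
    \<open>x e * A e x\<close> into \<gamma> times the mean of a variance.\<close>
  have parts2: "(\<integral>x. x e * A e x - \<gamma> * B e e x \<partial>gauss_prod E) = 0" if e: "e \<in> E" for e
  proof -
    have int: "integrable (gauss_prod E) (\<lambda>x. x e * A e x - \<gamma> * B e e x)"
      by (intro Bochner_Integration.integrable_diff integrable_mult_right I2 I4 e)
    have "(\<integral>y. y * A e (x(e := y)) - \<gamma> * B e e (x(e := y)) \<partial>std_gauss) = 0" for x
    proof (rule gaussian_integration_by_parts[OF dA[OF e e]])
      have t: "1 \<le> (1 + \<bar>y\<bar>)\<^sup>2" for y :: real
        by (rule one_le_power) simp
      show "isCont (\<lambda>y. \<gamma> * B e e (x(e := y))) y" for y
        by (intro continuous_intros cB e)
      show "\<bar>A e (x(e := y))\<bar> \<le> 1 * (1 + \<bar>y\<bar>) ^ 2" for y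
        using bA[OF e, of "x(e := y)"] t[of y] by linarith
      show "\<bar>\<gamma> * B e e (x(e := y))\<bar> \<le> (\<gamma> * 2) * (1 + \<bar>y\<bar>) ^ 2" for y
      proof -
        have "\<bar>\<gamma> * B e e (x(e := y))\<bar> \<le> \<gamma> * 2 * 1"
          using bB[OF e e, of "x(e := y)"] gamma by (simp add: abs_mult)
        also have "\<dots> \<le> (\<gamma> * 2) * (1 + \<bar>y\<bar>) ^ 2"
          using t[of y] gamma by (intro mult_left_mono) auto
        finally show ?thesis .
      qed
    qed
    then show ?thesis
      using integral_gauss_prod_coordinate[OF E e int] by simp
  qed
  \<comment> \<open>In \<open>parts1\<close> the middle term is subtracted, and by
    \<open>parts2\<close> its mean is nonnegative, so dropping it gives an upper bound for the
    covariance term.\<close>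
  have step: "\<gamma> * (a e * (\<integral>x. x e * C e x \<partial>gauss_prod E)) \<le> (\<integral>x. a e * (((x e)\<^sup>2 - 1) * W x) \<partial>gauss_prod E)"
    if e: "e \<in> E" for e
  proof -
    have "(\<integral>x. x e * A e x \<partial>gauss_prod E) = \<gamma> * (\<integral>x. B e e x \<partial>gauss_prod E)"
      using parts2[OF e] by (simp add: I2 I4 e)
    moreover have "0 \<le> (\<integral>x. B e e x \<partial>gauss_prod E)"
      by (rule Bochner_Integration.integral_nonneg) (rule pos[OF e])
    ultimately have "0 \<le> (a e)\<^sup>2 * (\<integral>x. x e * A e x \<partial>gauss_prod E)"
      using gamma by simp
    then show ?thesis
      using parts1[OF e] by (simp add: I1 I2 I3 e)
  qed
  have "\<gamma> * (\<integral>x. (\<Sum>e\<in>E. \<Sum>e'\<in>E. a e * a e' * x e * x e' * B e e' x) \<partial>gauss_prod E)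
    = \<gamma> * (\<integral>x. (\<Sum>e\<in>E. a e * (x e * C e x)) \<partial>gauss_prod E)"
    by (simp add: C_def sum_distrib_left mult_ac)
  also have "\<dots> = (\<Sum>e\<in>E. \<gamma> * (a e * (\<integral>x. x e * C e x \<partial>gauss_prod E)))"
    by (simp add: I3 sum_distrib_left)
  also have "\<dots> \<le> (\<Sum>e\<in>E. \<integral>x. a e * (((x e)\<^sup>2 - 1) * W x) \<partial>gauss_prod E)"
    by (intro sum_mono step)
  also have "\<dots> = (\<integral>x. Q x * W x \<partial>gauss_prod E)"
    by (simp add: I1 Q_def sum_distrib_right mult.assoc flip: Bochner_Integration.integral_sum)
  also have "\<dots> \<le> sqrt 2 * L2_set a E * K"
  proof (cases "L2_set a E = 0")
    case True
    then have "Q x = 0" for x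
      using E by (simp add: Q_def L2_set_eq_0_iff)
    then show ?thesis
      using True by simp
  next
    case False
    \<comment> \<open>Cauchy-Schwarz is carried out as a weighted arithmetic-geometric mean
      inequality for \<open>Q\<close> and each coordinate. The weight \<open>s\<close> is the L2
      norm of \<open>Q\<close>, which makes both halves integrate to the same value; the degenerate
      case \<open>s = 0\<close> was split off because of the division by \<open>s\<close>.\<close>
    define s where "s = sqrt 2 * L2_set a E"
    have s: "s > 0"
      unfolding s_def using False L2_set_nonneg[of a E] by (simp add: less_le)
    have x2: "integrable (gauss_prod E) (\<lambda>x. (x e)\<^sup>2)" if "e \<in> E" for e
    proof (rule integrable_gauss_prod_growth[OF E, of _ 1 2])
      show "\<bar>(x e)\<^sup>2\<bar> \<le> 1 * weight E x ^ 2" for x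
        using power_mono[OF abs_le_weight[OF E that, of x], of 2] by simp
    qed (use that in measurable)
    have x2v: "(\<integral>x. (x e)\<^sup>2 \<partial>gauss_prod E) = 1" if "e \<in> E" for e
      using integral_gauss_prod_component[OF E that x2[OF that]] by (simp add: std_gauss_moments)
    have Q2: "integrable (gauss_prod E) (\<lambda>x. (Q x)\<^sup>2)" "(\<integral>x. (Q x)\<^sup>2 \<partial>gauss_prod E) = s\<^sup>2"
      unfolding Q_def s_def using integral_gauss_prod_square[OF E, of a] by (auto simp: power_mult_distrib)
    have "(\<integral>x. Q x * W x \<partial>gauss_prod E)
      \<le> (\<integral>x. (\<Sum>e\<in>E. \<bar>a e\<bar> * ((Q x)\<^sup>2 / s + s * (x e)\<^sup>2) / 2) \<partial>gauss_prod E)"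
    proof (rule integral_mono)
      show "integrable (gauss_prod E) (\<lambda>x. Q x * W x)"
        unfolding Q_def sum_distrib_right mult.assoc
        by (intro Bochner_Integration.integrable_sum integrable_mult_right I1)
      show "integrable (gauss_prod E) (\<lambda>x. \<Sum>e\<in>E. \<bar>a e\<bar> * ((Q x)\<^sup>2 / s + s * (x e)\<^sup>2) / 2)"
        by (intro Bochner_Integration.integrable_sum integrable_divide integrable_mult_right
            Bochner_Integration.integrable_add Q2 x2)
      fix x
      have "Q x * (x e * A e x) \<le> ((Q x)\<^sup>2 / s + s * (x e)\<^sup>2) / 2 \<and>
          - (Q x * (x e * A e x)) \<le> ((Q x)\<^sup>2 / s + s * (x e)\<^sup>2) / 2" if "e \<in> E" for e
      proof -
        \<comment> \<open>Expanding this square is the weighted mean inequality; the factor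
          \<open>A e x\<close> is then absorbed because its modulus is at most 1.\<close>
        have "0 \<le> (\<bar>Q x\<bar> - s * \<bar>x e\<bar>)\<^sup>2 / s"
          using s by simp
        also have "\<dots> = (Q x)\<^sup>2 / s + s * (x e)\<^sup>2 - 2 * (\<bar>Q x\<bar> * \<bar>x e\<bar>)"
          using s by (simp add: power2_diff power_mult_distrib field_simps power2_eq_square)
        finally have "\<bar>Q x\<bar> * \<bar>x e\<bar> \<le> ((Q x)\<^sup>2 / s + s * (x e)\<^sup>2) / 2"
          by simp
        moreover have "\<bar>Q x * (x e * A e x)\<bar> \<le> \<bar>Q x\<bar> * \<bar>x e\<bar>"
          using mult_left_mono[OF bA[OF that, of x], of "\<bar>Q x\<bar> * \<bar>x e\<bar>"] by (simp add: abs_mult mult_ac)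
        ultimately show ?thesis
          by linarith
      qed
      then have *: "\<bar>Q x * (x e * A e x)\<bar> \<le> ((Q x)\<^sup>2 / s + s * (x e)\<^sup>2) / 2" if "e \<in> E" for e
        using that by (meson abs_le_iff)
      have "Q x * W x = (\<Sum>e\<in>E. a e * (Q x * (x e * A e x)))"
        by (simp add: W_def sum_distrib_left mult_ac)
      also have "\<dots> \<le> (\<Sum>e\<in>E. \<bar>a e\<bar> * \<bar>Q x * (x e * A e x)\<bar>)"
        by (intro sum_mono) (metis abs_ge_self abs_mult)
      also have "\<dots> \<le> (\<Sum>e\<in>E. \<bar>a e\<bar> * (((Q x)\<^sup>2 / s + s * (x e)\<^sup>2) / 2))"
        by (intro sum_mono mult_left_mono *) auto
      finally show "Q x * W x \<le> (\<Sum>e\<in>E. \<bar>a e\<bar> * ((Q x)\<^sup>2 / s + s * (x e)\<^sup>2) / 2)"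
        by simp
    qed
    also have "\<dots> = (\<Sum>e\<in>E. \<bar>a e\<bar> * (s\<^sup>2 / s + s * 1) / 2)"
      by (subst Bochner_Integration.integral_sum)
        (auto simp: Q2 x2 x2v intro!: sum.cong)
    also have "\<dots> = s * K"
      using s by (simp add: K_def power2_eq_square sum_distrib_left mult_ac)
    finally show ?thesis
      by (simp add: s_def)
  qed
  finally show ?thesis
    using gamma by (simp add: K_def field_simps)
qed

subsection \<open>Gibbs averages as functions of the Gaussian coordinates\<close>

text \<open>A Lipschitz bound for the exponential below \<open>m\<close>, obtained from
  \<open>1 + t \<le> exp t\<close>. It supplies the dominating function for differentiation under
  the integral sign.\<close>

lemma abs_exp_diff_le:
  fixes s t :: real
  assumes "s \<le> m" "t \<le> m"
  shows "\<bar>exp s - exp t\<bar> \<le> exp m * \<bar>s - t\<bar>"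
proof -
  have *: "exp s - exp t \<le> exp m * (s - t)" if "t \<le> s" "s \<le> m" for s t :: real
  proof -
    have "exp s - exp t = exp s * (1 - exp (t - s))"
      by (simp add: exp_diff field_simps)
    also have "\<dots> \<le> exp s * (s - t)"
    proof (rule mult_left_mono)
      show "1 - exp (t - s) \<le> s - t"
        using exp_ge_add_one_self[of "t - s"] by linarith
    qed simp
    also have "\<dots> \<le> exp m * (s - t)"
      using that by (intro mult_right_mono) auto
    finally show ?thesis .
  qed
  show ?thesis
    using *[of t s] *[of s t] assms by (cases "t \<le> s") auto
qed

text \<open>Dominated convergence for the difference quotients along an arbitrary null sequence.
  Since \<open>k\<close> is bounded, the quotients of the exponentials are uniformly bounded and
  \<psi> alone carries the integrability.\<close>

lemma DERIV_integral_exp: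
  fixes \<psi> k :: "'s \<Rightarrow> real"
  assumes psi: "integrable \<nu> \<psi>" and k [measurable]: "k \<in> borel_measurable \<nu>"
    and bk: "\<And>\<sigma>. \<sigma> \<in> space \<nu> \<Longrightarrow> \<bar>k \<sigma>\<bar> \<le> K"
  shows "((\<lambda>y. \<integral>\<sigma>. \<psi> \<sigma> * exp (y * k \<sigma>) \<partial>\<nu>) has_real_derivative
    (\<integral>\<sigma>. \<psi> \<sigma> * k \<sigma> * exp (y * k \<sigma>) \<partial>\<nu>)) (at y)"
  unfolding DERIV_def tendsto_at_iff_sequentially
proof (intro allI impI)
  have [measurable]: "\<psi> \<in> borel_measurable \<nu>"
    using psi by simp
  have le: "z * k \<sigma> \<le> \<bar>z\<bar> * K" if "\<sigma> \<in> space \<nu>" for z \<sigma>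
    using mult_left_mono[OF bk[OF that], of "\<bar>z\<bar>"] by (simp flip: abs_mult)
  have int: "integrable \<nu> (\<lambda>\<sigma>. \<psi> \<sigma> * exp (z * k \<sigma>))" for z
  proof (rule Bochner_Integration.integrable_bound)
    show "integrable \<nu> (\<lambda>\<sigma>. \<psi> \<sigma> * exp (\<bar>z\<bar> * K))"
      using psi by simp
    show "AE \<sigma> in \<nu>. norm (\<psi> \<sigma> * exp (z * k \<sigma>)) \<le> norm (\<psi> \<sigma> * exp (\<bar>z\<bar> * K))"
      using le by (intro AE_I2) (auto simp: abs_mult intro!: mult_left_mono)
  qed simp
  fix X :: "nat \<Rightarrow> real"
  assume X: "\<forall>i. X i \<in> UNIV - {0}" and lim: "X \<longlonglongrightarrow> 0"
  \<comment> \<open>The null sequence is bounded, so all exponents stay below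
    \<open>(\<bar>y\<bar> + R) * K\<close> and one dominating function serves every index.\<close>
  obtain R where R: "\<And>i. \<bar>X i\<bar> \<le> R"
    using convergent_imp_Bseq[of X] lim by (auto simp: convergent_def Bseq_def)
  let ?q = "\<lambda>i \<sigma>. \<psi> \<sigma> * ((exp ((y + X i) * k \<sigma>) - exp (y * k \<sigma>)) / X i)"
  have "(\<lambda>i. \<integral>\<sigma>. ?q i \<sigma> \<partial>\<nu>) \<longlonglongrightarrow> (\<integral>\<sigma>. \<psi> \<sigma> * (k \<sigma> * exp (y * k \<sigma>)) \<partial>\<nu>)"
  proof (rule integral_dominated_convergence)
    show "integrable \<nu> (\<lambda>\<sigma>. \<bar>\<psi> \<sigma>\<bar> * (exp ((\<bar>y\<bar> + R) * K) * K))"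
      using psi by simp
    show "AE \<sigma> in \<nu>. (\<lambda>i. ?q i \<sigma>) \<longlonglongrightarrow> \<psi> \<sigma> * (k \<sigma> * exp (y * k \<sigma>))"
    proof (intro AE_I2 tendsto_mult_left)
      fix \<sigma>
      have "((\<lambda>y. exp (y * k \<sigma>)) has_real_derivative k \<sigma> * exp (y * k \<sigma>)) (at y)"
        by (auto intro!: derivative_eq_intros)
      then show "(\<lambda>i. (exp ((y + X i) * k \<sigma>) - exp (y * k \<sigma>)) / X i) \<longlonglongrightarrow> k \<sigma> * exp (y * k \<sigma>)"
        using X lim unfolding DERIV_def tendsto_at_iff_sequentially by (auto simp: o_def)
    qed
    show "AE \<sigma> in \<nu>. norm (?q i \<sigma>) \<le> \<bar>\<psi> \<sigma>\<bar> * (exp ((\<bar>y\<bar> + R) * K) * K)" for i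
    proof (rule AE_I2)
      fix \<sigma> assume \<sigma>: "\<sigma> \<in> space \<nu>"
      have K: "0 \<le> K"
        using bk[OF \<sigma>] by linarith
      have R0: "0 \<le> R"
        using R[of 0] by linarith
      have "(y + X i) * k \<sigma> \<le> (\<bar>y\<bar> + R) * K"
        using R[of i] K by (intro order_trans[OF le[OF \<sigma>]] mult_right_mono) auto
      moreover have "y * k \<sigma> \<le> (\<bar>y\<bar> + R) * K"
        using R0 K by (intro order_trans[OF le[OF \<sigma>]] mult_right_mono) auto
      ultimately have "\<bar>exp ((y + X i) * k \<sigma>) - exp (y * k \<sigma>)\<bar>
          \<le> exp ((\<bar>y\<bar> + R) * K) * \<bar>(y + X i) * k \<sigma> - y * k \<sigma>\<bar>"
        by (rule abs_exp_diff_le)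
      also have "\<dots> = exp ((\<bar>y\<bar> + R) * K) * \<bar>k \<sigma>\<bar> * \<bar>X i\<bar>"
        by (simp add: algebra_simps abs_mult)
      also have "\<dots> \<le> exp ((\<bar>y\<bar> + R) * K) * K * \<bar>X i\<bar>"
        using bk[OF \<sigma>] by (intro mult_right_mono mult_left_mono) auto
      finally have "\<bar>exp ((y + X i) * k \<sigma>) - exp (y * k \<sigma>)\<bar> / \<bar>X i\<bar> \<le> exp ((\<bar>y\<bar> + R) * K) * K"
        using X by (simp add: divide_le_eq)
      then have "\<bar>\<psi> \<sigma>\<bar> * (\<bar>exp ((y + X i) * k \<sigma>) - exp (y * k \<sigma>)\<bar> / \<bar>X i\<bar>)
          \<le> \<bar>\<psi> \<sigma>\<bar> * (exp ((\<bar>y\<bar> + R) * K) * K)"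
        by (rule mult_left_mono) simp
      then show "norm (?q i \<sigma>) \<le> \<bar>\<psi> \<sigma>\<bar> * (exp ((\<bar>y\<bar> + R) * K) * K)"
        by (simp only: real_norm_def abs_mult abs_divide)
    qed
  qed simp_all
  moreover have "?q i = (\<lambda>\<sigma>. (\<psi> \<sigma> * exp ((y + X i) * k \<sigma>) - \<psi> \<sigma> * exp (y * k \<sigma>)) / X i)" for i
    by (simp add: right_diff_distrib)
  moreover have "(\<integral>\<sigma>. (\<psi> \<sigma> * exp ((y + X i) * k \<sigma>) - \<psi> \<sigma> * exp (y * k \<sigma>)) / X i \<partial>\<nu>)
      = ((\<integral>\<sigma>. \<psi> \<sigma> * exp ((y + X i) * k \<sigma>) \<partial>\<nu>) - (\<integral>\<sigma>. \<psi> \<sigma> * exp (y * k \<sigma>) \<partial>\<nu>)) / X i" for i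
    using int by simp
  ultimately show "((\<lambda>h. ((\<integral>\<sigma>. \<psi> \<sigma> * exp ((y + h) * k \<sigma>) \<partial>\<nu>) - (\<integral>\<sigma>. \<psi> \<sigma> * exp (y * k \<sigma>) \<partial>\<nu>)) / h) \<circ> X)
      \<longlonglongrightarrow> (\<integral>\<sigma>. \<psi> \<sigma> * k \<sigma> * exp (y * k \<sigma>) \<partial>\<nu>)"
    by (simp only: o_def mult.assoc)
qed

section \<open>The Gibbs measure for frozen disorder\<close>

text \<open>One realisation of the random measure and of the random functions is fixed as \<nu> and
  \<open>h\<close>. The Gaussian vector remains a free argument \<open>x\<close> of the averages, so
  that they can be differentiated in its coordinates.\<close>

locale gibbs_system = finite_measure \<nu> for \<nu> :: "'s measure" +
  fixes E :: "'e set" and h :: "'e \<Rightarrow> 's \<Rightarrow> real" and \<gamma> :: real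
  assumes nonzero: "emeasure \<nu> (space \<nu>) \<noteq> 0"
    and finite_index: "finite E"
    and h_measurable [measurable]: "\<And>e. e \<in> E \<Longrightarrow> h e \<in> borel_measurable \<nu>"
    and h_bound: "\<And>e \<sigma>. e \<in> E \<Longrightarrow> \<sigma> \<in> space \<nu> \<Longrightarrow> \<bar>h e \<sigma>\<bar> \<le> 1"
begin

abbreviation energy :: "('e \<Rightarrow> real) \<Rightarrow> 's \<Rightarrow> real" where
  "energy x \<sigma> \<equiv> \<gamma> * gauss_field E x h \<sigma>"

abbreviation gibbs :: "('e \<Rightarrow> real) \<Rightarrow> 's measure" where
  "gibbs x \<equiv> gibbs_measure \<nu> (energy x)"

abbreviation avg :: "('s \<Rightarrow> real) \<Rightarrow> ('e \<Rightarrow> real) \<Rightarrow> real" where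
  "avg \<phi> x \<equiv> (\<integral>\<sigma>. \<phi> \<sigma> \<partial>gibbs x)"

text \<open>The unnormalised Gibbs average. Averages are quotients of two such integrals, and each
  can be differentiated under the integral sign.\<close>

definition tilted :: "('s \<Rightarrow> real) \<Rightarrow> ('e \<Rightarrow> real) \<Rightarrow> real" where
  "tilted \<phi> x = (\<integral>\<sigma>. \<phi> \<sigma> * exp (energy x \<sigma>) \<partial>\<nu>)"

lemma energy_measurable [measurable]: "energy x \<in> borel_measurable \<nu>"
  unfolding gauss_field_def by measurable

lemma energy_bound:
  assumes "\<sigma> \<in> space \<nu>"
  shows "\<bar>energy x \<sigma>\<bar> \<le> \<bar>\<gamma>\<bar> * (\<Sum>e\<in>E. \<bar>x e\<bar>)"
  unfolding gauss_field_def abs_mult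
  by (intro mult_left_mono order_trans[OF sum_abs] sum_mono)
    (auto simp: abs_mult h_bound assms intro: mult_left_le)

lemma tilted_integrable:
  assumes [measurable]: "\<phi> \<in> borel_measurable \<nu>"
    and "\<And>\<sigma>. \<sigma> \<in> space \<nu> \<Longrightarrow> \<bar>\<phi> \<sigma>\<bar> \<le> C"
  shows "integrable \<nu> (\<lambda>\<sigma>. \<phi> \<sigma> * exp (energy x \<sigma>))"
proof (rule integrable_const_bound)
  show "AE \<sigma> in \<nu>. norm (\<phi> \<sigma> * exp (energy x \<sigma>)) \<le> C * exp (\<bar>\<gamma>\<bar> * (\<Sum>e\<in>E. \<bar>x e\<bar>))"
  proof (rule AE_I2)
    fix \<sigma> assume \<sigma>: "\<sigma> \<in> space \<nu>"
    have "\<bar>\<phi> \<sigma>\<bar> * exp (energy x \<sigma>) \<le> C * exp (\<bar>\<gamma>\<bar> * (\<Sum>e\<in>E. \<bar>x e\<bar>))"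
      using assms(2)[OF \<sigma>] energy_bound[OF \<sigma>, of x] by (intro mult_mono) auto
    then show "norm (\<phi> \<sigma> * exp (energy x \<sigma>)) \<le> C * exp (\<bar>\<gamma>\<bar> * (\<Sum>e\<in>E. \<bar>x e\<bar>))"
      by (simp add: abs_mult)
  qed
qed measurable

lemma exp_energy_integrable: "integrable \<nu> (\<lambda>\<sigma>. exp (energy x \<sigma>))"
  using tilted_integrable[of "\<lambda>_. 1" 1] by simp

lemma tilted_1: "tilted (\<lambda>_. 1) x = partition_function \<nu> (energy x)"
  by (simp add: tilted_def partition_function_def)

text \<open>The energy is bounded for a fixed Gaussian vector, so the integrand is bounded below by
  a positive constant, and the total mass is nonzero.\<close>

lemma partition_function_pos: "0 < partition_function \<nu> (energy x)"
proof -
  let ?c = "exp (- (\<bar>\<gamma>\<bar> * (\<Sum>e\<in>E. \<bar>x e\<bar>)))"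
  have "0 < measure \<nu> (space \<nu>)"
    using nonzero by (simp add: emeasure_eq_measure less_le)
  then have "0 < (\<integral>\<sigma>. ?c \<partial>\<nu>)"
    by simp
  also have "\<dots> \<le> (\<integral>\<sigma>. exp (energy x \<sigma>) \<partial>\<nu>)"
  proof (rule integral_mono[OF _ exp_energy_integrable])
    show "?c \<le> exp (energy x \<sigma>)" if "\<sigma> \<in> space \<nu>" for \<sigma>
      using energy_bound[OF that, of x] by (simp add: abs_le_iff)
  qed simp
  finally show ?thesis
    by (simp add: partition_function_def)
qed

lemma space_gibbs [simp]: "space (gibbs x) = space \<nu>"
  by (simp add: gibbs_measure_def)

lemma sets_gibbs [simp, measurable_cong]: "sets (gibbs x) = sets \<nu>"
  by (simp add: gibbs_measure_def)

lemma prob_space_gibbs: "prob_space (gibbs x)"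
proof
  let ?Z = "partition_function \<nu> (energy x)"
  have "emeasure (gibbs x) (space (gibbs x)) = (\<integral>\<^sup>+\<sigma>. ennreal (exp (energy x \<sigma>) / ?Z) \<partial>\<nu>)"
    by (simp add: gibbs_measure_def emeasure_density cong: nn_integral_cong)
  also have "\<dots> = ennreal (\<integral>\<sigma>. exp (energy x \<sigma>) / ?Z \<partial>\<nu>)"
    using partition_function_pos[of x]
    by (intro nn_integral_eq_integral integrable_divide exp_energy_integrable) auto
  also have "(\<integral>\<sigma>. exp (energy x \<sigma>) / ?Z \<partial>\<nu>) = 1"
    using partition_function_pos[of x] by (simp add: partition_function_def)
  finally show "emeasure (gibbs x) (space (gibbs x)) = 1"
    by simp
qed

lemma avg_eq:
  assumes [measurable]: "\<phi> \<in> borel_measurable \<nu>"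
  shows "avg \<phi> x = tilted \<phi> x / tilted (\<lambda>_. 1) x"
proof -
  have "avg \<phi> x = (\<integral>\<sigma>. (exp (energy x \<sigma>) / partition_function \<nu> (energy x)) *\<^sub>R \<phi> \<sigma> \<partial>\<nu>)"
    unfolding gibbs_measure_def using partition_function_pos[of x]
    by (intro integral_density) auto
  also have "\<dots> = tilted \<phi> x / tilted (\<lambda>_. 1) x"
    unfolding tilted_1 by (simp add: tilted_def mult.commute)
  finally show ?thesis .
qed

lemma gibbs_integrable:
  fixes \<phi> :: "'s \<Rightarrow> real"
  assumes [measurable]: "\<phi> \<in> borel_measurable \<nu>"
    and "\<And>\<sigma>. \<sigma> \<in> space \<nu> \<Longrightarrow> \<bar>\<phi> \<sigma>\<bar> \<le> C"
  shows "integrable (gibbs x) \<phi>"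
proof -
  interpret G: prob_space "gibbs x" by (rule prob_space_gibbs)
  show ?thesis
    using assms(2) by (intro G.integrable_const_bound[of _ C] AE_I2) auto
qed

lemma abs_avg_le:
  assumes "\<phi> \<in> borel_measurable \<nu>"
    and "\<And>\<sigma>. \<sigma> \<in> space \<nu> \<Longrightarrow> \<bar>\<phi> \<sigma>\<bar> \<le> C"
  shows "\<bar>avg \<phi> x\<bar> \<le> C"
proof -
  interpret G: prob_space "gibbs x" by (rule prob_space_gibbs)
  have "\<bar>avg \<phi> x\<bar> \<le> (\<integral>\<sigma>. \<bar>\<phi> \<sigma>\<bar> \<partial>gibbs x)"
    by (rule integral_abs_bound)
  also have "\<dots> \<le> (\<integral>\<sigma>. C \<partial>gibbs x)"
    using assms(2) by (intro integral_mono integrable_abs gibbs_integrable[OF assms]) auto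
  finally show ?thesis
    using G.prob_space by simp
qed

lemma tilted_deriv:
  assumes \<phi> [measurable]: "\<phi> \<in> borel_measurable \<nu>"
    and b: "\<And>\<sigma>. \<sigma> \<in> space \<nu> \<Longrightarrow> \<bar>\<phi> \<sigma>\<bar> \<le> C"
    and e: "e \<in> E"
  shows "((\<lambda>y. tilted \<phi> (x(e := y))) has_real_derivative
    \<gamma> * tilted (\<lambda>\<sigma>. \<phi> \<sigma> * h e \<sigma>) (x(e := y))) (at y)"
proof -
  have [measurable]: "h e \<in> borel_measurable \<nu>"
    using e by measurable
  \<comment> \<open>The energy is affine in the coordinate \<open>e\<close>. Its constant part
    \<open>r\<close> is absorbed into the integrable factor, and the slope
    \<open>\<gamma> * h e\<close> is bounded by the modulus of \<gamma>.\<close>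
  define r where "r = energy (x(e := 0))"
  have split: "energy (x(e := y)) \<sigma> = r \<sigma> + y * (\<gamma> * h e \<sigma>)" for y \<sigma>
    using finite_index e by (simp add: r_def gauss_field_def sum.remove algebra_simps)
  have "integrable \<nu> (\<lambda>\<sigma>. \<phi> \<sigma> * exp (r \<sigma>))"
    unfolding r_def by (rule tilted_integrable[OF \<phi> b])
  then have "((\<lambda>y. \<integral>\<sigma>. \<phi> \<sigma> * exp (r \<sigma>) * exp (y * (\<gamma> * h e \<sigma>)) \<partial>\<nu>) has_real_derivative
      (\<integral>\<sigma>. \<phi> \<sigma> * exp (r \<sigma>) * (\<gamma> * h e \<sigma>) * exp (y * (\<gamma> * h e \<sigma>)) \<partial>\<nu>)) (at y)"
    by (rule DERIV_integral_exp[where K = "\<bar>\<gamma>\<bar>"])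
      (auto intro!: mult_left_le simp: h_bound e abs_mult)
  moreover have "(\<integral>\<sigma>. \<phi> \<sigma> * exp (r \<sigma>) * (\<gamma> * h e \<sigma>) * exp (y * (\<gamma> * h e \<sigma>)) \<partial>\<nu>)
      = (\<integral>\<sigma>. \<gamma> * (\<phi> \<sigma> * h e \<sigma> * (exp (r \<sigma>) * exp (y * (\<gamma> * h e \<sigma>)))) \<partial>\<nu>)"
    by (simp only: mult_ac)
  ultimately show ?thesis
    unfolding tilted_def split by (simp add: exp_add mult.assoc)
qed

definition cov :: "'e \<Rightarrow> 'e \<Rightarrow> ('e \<Rightarrow> real) \<Rightarrow> real" where
  "cov e e' x = avg (\<lambda>\<sigma>. h e \<sigma> * h e' \<sigma>) x - avg (h e) x * avg (h e') x"

lemma h_mult_bound: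
  assumes "e \<in> E" "e' \<in> E" "\<sigma> \<in> space \<nu>"
  shows "\<bar>h e \<sigma> * h e' \<sigma>\<bar> \<le> 1"
  using mult_mono[OF h_bound[of e \<sigma>] h_bound[of e' \<sigma>]] assms by (simp add: abs_mult)

text \<open>The quotient rule: differentiating the numerator inserts \<open>\<gamma> * h e\<close>
  under the average, and differentiating the partition function subtracts the product of the two
  averages.\<close>

lemma avg_deriv:
  assumes e: "e \<in> E" "e' \<in> E"
  shows "((\<lambda>y. avg (h e') (x(e := y))) has_real_derivative \<gamma> * cov e e' (x(e := y))) (at y)"
proof -
  have [measurable]: "h e \<in> borel_measurable \<nu>" "h e' \<in> borel_measurable \<nu>"
    using e by measurable
  let ?N = "\<lambda>\<phi>. tilted \<phi> (x(e := y))"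
  have Z: "?N (\<lambda>_. 1) \<noteq> 0"
    using partition_function_pos by (simp add: tilted_1 less_imp_neq[symmetric])
  have "((\<lambda>y. tilted (h e') (x(e := y)) / tilted (\<lambda>_. 1) (x(e := y))) has_real_derivative
      ((\<gamma> * ?N (\<lambda>\<sigma>. h e' \<sigma> * h e \<sigma>)) * ?N (\<lambda>_. 1) - ?N (h e') * (\<gamma> * ?N (\<lambda>\<sigma>. 1 * h e \<sigma>)))
        / (?N (\<lambda>_. 1) * ?N (\<lambda>_. 1))) (at y)"
    using h_bound e Z by (intro DERIV_divide tilted_deriv) auto
  moreover have "(\<gamma> * p * z - q * (\<gamma> * r)) / (z * z) = \<gamma> * (p / z - r / z * (q / z))"
    if "z \<noteq> 0" for p q r z :: real
    using that by (simp add: field_simps)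
  ultimately show ?thesis
    using Z by (simp add: avg_eq cov_def mult.commute[of "h e _"])
qed

lemma cov_isCont:
  assumes e: "e \<in> E" "e' \<in> E"
  shows "isCont (\<lambda>y. cov e e' (x(e := y))) y"
proof -
  have [measurable]: "h e \<in> borel_measurable \<nu>" "h e' \<in> borel_measurable \<nu>"
    using e by measurable
  have "isCont (\<lambda>y. tilted \<phi> (x(e := y))) y"
    if "\<phi> \<in> borel_measurable \<nu>" "\<And>\<sigma>. \<sigma> \<in> space \<nu> \<Longrightarrow> \<bar>\<phi> \<sigma>\<bar> \<le> 1" for \<phi>
    by (rule DERIV_isCont[OF tilted_deriv[OF that e(1)]])
  moreover have "tilted (\<lambda>_. 1) z \<noteq> 0" for z
    using partition_function_pos by (simp add: tilted_1 less_imp_neq[symmetric])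
  ultimately show ?thesis
    unfolding cov_def using e
    by (simp add: avg_eq) (intro continuous_intros; simp add: h_bound h_mult_bound)
qed

lemma abs_cov_le:
  assumes e: "e \<in> E" "e' \<in> E"
  shows "\<bar>cov e e' x\<bar> \<le> 2"
proof -
  have [measurable]: "h e \<in> borel_measurable \<nu>" "h e' \<in> borel_measurable \<nu>"
    using e by measurable
  have "\<bar>avg (\<lambda>\<sigma>. h e \<sigma> * h e' \<sigma>) x\<bar> \<le> 1"
    by (rule abs_avg_le) (auto simp: h_mult_bound e)
  moreover have "\<bar>avg (h e) x * avg (h e') x\<bar> \<le> 1 * 1"
    unfolding abs_mult by (intro mult_mono abs_avg_le h_bound) (auto simp: e)
  ultimately show ?thesis
    unfolding cov_def by linarith
qed

text \<open>The diagonal covariance is the variance of \<open>h e\<close> under a probability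
  measure.\<close>

lemma cov_self_nonneg:
  assumes e: "e \<in> E"
  shows "0 \<le> cov e e x"
proof -
  interpret G: prob_space "gibbs x" by (rule prob_space_gibbs)
  have [measurable]: "h e \<in> borel_measurable \<nu>"
    using e by measurable
  have "integrable (gibbs x) (h e)"
    by (rule gibbs_integrable[where C = 1]) (simp_all add: h_bound e)
  moreover have "integrable (gibbs x) (\<lambda>\<sigma>. (h e \<sigma>)\<^sup>2)"
    unfolding power2_eq_square
    by (rule gibbs_integrable[where C = 1]) (measurable, rule h_mult_bound[OF e e])
  ultimately have "G.variance (h e) = cov e e x"
    unfolding cov_def by (subst G.variance_eq) (simp_all add: power2_eq_square)
  then show ?thesis
    using G.variance_positive[of "h e"] by simp
qed

text \<open>Bilinearity of the covariance puts the Gibbs variance of the field into the form bounded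
  in \<open>gaussian_covariance_bound\<close>, with \<open>cov\<close> in the role of
  \<open>B\<close>.\<close>

lemma variance_gauss_field:
  "avg (\<lambda>\<sigma>. (gauss_field E (\<lambda>e. a e * x e) h \<sigma>)\<^sup>2) x - (avg (gauss_field E (\<lambda>e. a e * x e) h) x)\<^sup>2
    = (\<Sum>e\<in>E. \<Sum>e'\<in>E. a e * a e' * x e * x e' * cov e e' x)"
proof -
  have i1: "integrable (gibbs x) (h e)" if "e \<in> E" for e
    by (rule gibbs_integrable[where C = 1]) (auto simp: h_bound that)
  have i2: "integrable (gibbs x) (\<lambda>\<sigma>. h e \<sigma> * h e' \<sigma>)" if "e \<in> E" "e' \<in> E" for e e'
    using that by (intro gibbs_integrable[where C = 1]) (auto simp: h_mult_bound)
  have "avg (gauss_field E (\<lambda>e. a e * x e) h) x = avg (\<lambda>\<sigma>. \<Sum>e\<in>E. a e * x e * h e \<sigma>) x"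
    by (intro Bochner_Integration.integral_cong refl) (simp add: gauss_field_def)
  then have "avg (gauss_field E (\<lambda>e. a e * x e) h) x = (\<Sum>e\<in>E. a e * x e * avg (h e) x)"
    by (simp add: i1)
  then have m: "(avg (gauss_field E (\<lambda>e. a e * x e) h) x)\<^sup>2
    = (\<Sum>e\<in>E. \<Sum>e'\<in>E. a e * a e' * x e * x e' * (avg (h e) x * avg (h e') x))"
    by (simp add: power2_eq_square sum_product mult_ac)
  have "(gauss_field E (\<lambda>e. a e * x e) h \<sigma>)\<^sup>2
    = (\<Sum>e\<in>E. \<Sum>e'\<in>E. a e * a e' * x e * x e' * (h e \<sigma> * h e' \<sigma>))" for \<sigma>
    by (simp add: gauss_field_def power2_eq_square sum_product mult_ac)
  then have "avg (\<lambda>\<sigma>. (gauss_field E (\<lambda>e. a e * x e) h \<sigma>)\<^sup>2) x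
    = (\<Sum>e\<in>E. \<Sum>e'\<in>E. a e * a e' * x e * x e' * avg (\<lambda>\<sigma>. h e \<sigma> * h e' \<sigma>) x)"
    by (simp add: i2)
  with m show ?thesis
    by (simp add: cov_def right_diff_distrib sum_subtractf)
qed

end

subsection \<open>Averaging over the disorder\<close>

text \<open>This makes Gibbs averages jointly measurable in the disorder and the Gaussian vector.
  The parameter \<open>p\<close> may carry more than the outcome that selects the measure;
  \<open>t\<close> extracts that outcome.\<close>

lemma measurable_integral_finite_kernel:
  fixes F :: "'p \<Rightarrow> 's \<Rightarrow> real"
  assumes ker: "finite_nonzero_kernel D S \<mu>"
    and t [measurable]: "t \<in> P \<rightarrow>\<^sub>M D"
    and F [measurable]: "(\<lambda>(p, \<sigma>). F p \<sigma>) \<in> borel_measurable (P \<Otimes>\<^sub>M S)"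
  shows "(\<lambda>p. \<integral>\<sigma>. F p \<sigma> \<partial>\<mu> (t p)) \<in> borel_measurable P"
proof -
  have sets: "sets (\<mu> \<omega>) = sets S" and fin: "finite_measure (\<mu> \<omega>)"
    and nz: "emeasure (\<mu> \<omega>) (space S) \<noteq> 0" if "\<omega> \<in> space D" for \<omega>
    using ker that unfolding finite_nonzero_kernel_def by auto
  have [measurable]: "(\<lambda>\<omega>. emeasure (\<mu> \<omega>) A) \<in> borel_measurable D" if "A \<in> sets S" for A
    using ker that unfolding finite_nonzero_kernel_def by auto
  define m where "m \<omega> = measure (\<mu> \<omega>) (space S)" for \<omega>
  have [measurable]: "m \<in> borel_measurable D"
    unfolding m_def measure_def by measurable
  have m: "0 < m \<omega>" "emeasure (\<mu> \<omega>) (space S) = ennreal (m \<omega>)" if "\<omega> \<in> space D" for \<omega>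
    using nz[OF that] finite_measure.emeasure_eq_measure[OF fin[OF that], of "space S"]
    by (auto simp: m_def less_le)
  \<comment> \<open>Normalising the kernel makes the measurability results for \<open>subprob_algebra\<close> applicable.\<close>
  define L where "L p = density (\<mu> (t p)) (\<lambda>_. ennreal (1 / m (t p)))" for p
  have tD: "t p \<in> space D" if "p \<in> space P" for p
    using measurable_space[OF t that] .
  have emL: "emeasure (L p) A = ennreal (1 / m (t p)) * emeasure (\<mu> (t p)) A"
    if "p \<in> space P" "A \<in> sets S" for p A
    unfolding L_def using sets[OF tD[OF that(1)]] that by (simp add: emeasure_density_const)
  have "L \<in> P \<rightarrow>\<^sub>M subprob_algebra S"
  proof (rule measurable_subprob_algebra)
    fix p assume p: "p \<in> space P"
    show setsL: "sets (L p) = sets S"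
      unfolding L_def using sets[OF tD[OF p]] by simp
    have sp: "space (L p) = space S"
      using sets_eq_imp_space_eq[OF setsL] .
    have "emeasure (L p) (space (L p)) = 1"
      unfolding sp using m[OF tD[OF p]] by (simp add: emL[OF p] flip: ennreal_mult)
    then have "prob_space (L p)"
      by (rule prob_spaceI)
    then show "subprob_space (L p)"
      by (rule prob_space_imp_subprob_space)
  next
    fix A assume [measurable]: "A \<in> sets S"
    have "(\<lambda>p. ennreal (1 / m (t p)) * emeasure (\<mu> (t p)) A) \<in> borel_measurable P"
      by measurable
    then show "(\<lambda>p. emeasure (L p) A) \<in> borel_measurable P"
      by (rule measurable_cong[THEN iffD1, rotated]) (simp add: emL)
  qed
  note L [measurable] = this
  note measurable_distr2 [measurable]
  \<comment> \<open>The integrand varies with \<open>p\<close> as well. Pushing \<open>L p\<close>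
    to the fibre over \<open>p\<close> in the product space turns the integral into that of one
    fixed function against a measurable kernel.\<close>
  have "(\<lambda>p. \<integral>(p, \<sigma>). F p \<sigma> \<partial>distr (L p) (P \<Otimes>\<^sub>M S) (\<lambda>\<sigma>. (p, \<sigma>))) \<in> borel_measurable P"
    by measurable
  then have "(\<lambda>p. \<integral>\<sigma>. F p \<sigma> \<partial>L p) \<in> borel_measurable P"
    by (rule measurable_cong[THEN iffD1, rotated]) (simp add: integral_distr)
  then have "(\<lambda>p. m (t p) * (\<integral>\<sigma>. F p \<sigma> \<partial>L p)) \<in> borel_measurable P"
    by measurable
  then show ?thesis
  proof (rule measurable_cong[THEN iffD1, rotated])
    fix p assume p: "p \<in> space P"
    have "(\<lambda>\<sigma>. (case (p, \<sigma>) of (p, \<sigma>) \<Rightarrow> F p \<sigma>)) \<in> borel_measurable S"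
      using p by measurable
    then have [measurable]: "F p \<in> borel_measurable (\<mu> (t p))"
      by (simp cong: measurable_cong_sets add: sets[OF tD[OF p]])
    show "m (t p) * (\<integral>\<sigma>. F p \<sigma> \<partial>L p) = (\<integral>\<sigma>. F p \<sigma> \<partial>\<mu> (t p))"
      unfolding L_def using m(1)[OF tD[OF p]] by (subst integral_density) (auto simp: less_imp_le)
  qed
qed

text \<open>Independence gives the product formula on measurable rectangles, and these determine the
  joint law. The first component is the outcome itself, seen through \<open>D\<close>, so every
  \<open>D\<close>-measurable quantity is a function of it.\<close>

lemma (in prob_space) distr_Pair_indep_set:
  assumes sub: "subalgebra M D" and X [measurable]: "X \<in> M \<rightarrow>\<^sub>M N"
    and indep: "indep_set (sets D) (sets (vimage_algebra (space M) X N))"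
  shows "distr M (D \<Otimes>\<^sub>M N) (\<lambda>\<omega>. (\<omega>, X \<omega>)) = distr M D (\<lambda>\<omega>. \<omega>) \<Otimes>\<^sub>M distr M N X"
proof (rule pair_measure_eqI[symmetric])
  have spD: "space D = space M" and id [measurable]: "(\<lambda>\<omega>. \<omega>) \<in> M \<rightarrow>\<^sub>M D"
    using sub by (auto simp: subalgebra_def measurable_def)
  interpret P: prob_space "distr M D (\<lambda>\<omega>. \<omega>)"
    by (rule prob_space_distr) measurable
  interpret Q: prob_space "distr M N X"
    by (rule prob_space_distr) measurable
  show "sigma_finite_measure (distr M D (\<lambda>\<omega>. \<omega>))" "sigma_finite_measure (distr M N X)"
    by unfold_locales
  show "sets (distr M D (\<lambda>\<omega>. \<omega>) \<Otimes>\<^sub>M distr M N X) = sets (distr M (D \<Otimes>\<^sub>M N) (\<lambda>\<omega>. (\<omega>, X \<omega>)))"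
    by (simp cong: sets_pair_measure_cong)
  fix A B
  assume "A \<in> sets (distr M D (\<lambda>\<omega>. \<omega>))" "B \<in> sets (distr M N X)"
  then have [measurable]: "A \<in> sets D" "B \<in> sets N"
    by simp_all
  have A: "A \<inter> space M = A"
    using sets.sets_into_space[OF \<open>A \<in> sets D\<close>] spD by auto
  have "emeasure (distr M (D \<Otimes>\<^sub>M N) (\<lambda>\<omega>. (\<omega>, X \<omega>))) (A \<times> B)
      = emeasure M ((\<lambda>\<omega>. (\<omega>, X \<omega>)) -` (A \<times> B) \<inter> space M)"
    by (rule emeasure_distr) measurable
  also have "(\<lambda>\<omega>. (\<omega>, X \<omega>)) -` (A \<times> B) \<inter> space M = A \<inter> (X -` B \<inter> space M)"
    by auto
  also have "emeasure M \<dots> = emeasure M A * emeasure M (X -` B \<inter> space M)"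
    using indep_setD[OF indep \<open>A \<in> sets D\<close> in_vimage_algebra[OF \<open>B \<in> sets N\<close>]]
    by (simp add: emeasure_eq_measure ennreal_mult)
  finally show "emeasure (distr M D (\<lambda>\<omega>. \<omega>)) A * emeasure (distr M N X) B
      = emeasure (distr M (D \<Otimes>\<^sub>M N) (\<lambda>\<omega>. (\<omega>, X \<omega>))) (A \<times> B)"
    by (simp add: emeasure_distr A)
qed

theorem theorem4:
  fixes M D :: "'w measure" and S :: "'s measure" and E :: "'e set"
    and g :: "'e \<Rightarrow> 'w \<Rightarrow> real" and f :: "'e \<Rightarrow> 'w \<Rightarrow> 's \<Rightarrow> real" and \<mu> :: "'w \<Rightarrow> 's measure"
    and a :: "'e \<Rightarrow> real" and \<gamma> :: real
    and Y W :: "'w \<Rightarrow> 's \<Rightarrow> real" and G :: "'w \<Rightarrow> 's measure"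
  assumes disorder: "gibbs_disorder M D S E g f \<mu>"
    and gamma: "\<gamma> > 0"
  defines "Y \<equiv> \<lambda>\<omega>. gauss_field E (\<lambda>e. g e \<omega>) (\<lambda>e. f e \<omega>)"
    and "W \<equiv> \<lambda>\<omega>. gauss_field E (\<lambda>e. a e * g e \<omega>) (\<lambda>e. f e \<omega>)"
    and "G \<equiv> \<lambda>\<omega>. gibbs_measure (\<mu> \<omega>) (\<lambda>\<sigma>. \<gamma> * Y \<omega> \<sigma>)"
  shows "integrable M (\<lambda>\<omega>. (\<integral>\<sigma>. (W \<omega> \<sigma>)\<^sup>2 \<partial>G \<omega>) - (\<integral>\<sigma>. W \<omega> \<sigma> \<partial>G \<omega>)\<^sup>2) \<and>
    prob_space.expectation M (\<lambda>\<omega>. (\<integral>\<sigma>. (W \<omega> \<sigma>)\<^sup>2 \<partial>G \<omega>) - (\<integral>\<sigma>. W \<omega> \<sigma> \<partial>G \<omega>)\<^sup>2)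
      \<le> sqrt 2 / \<gamma> * L2_set a E * (\<Sum>e\<in>E. \<bar>a e\<bar>)"
proof (cases "E = {}")
  case True
  then show ?thesis
    by (simp add: W_def gauss_field_def)
next
  \<comment> \<open>The empty index set is split off because independence of the Gaussians is turned
    into a product law for a nonempty family.\<close>
  case nonempty: False
  interpret M: prob_space M
    using disorder by (simp add: gibbs_disorder_def)
  have E: "finite E" and indep: "M.indep_vars (\<lambda>_. borel) g E"
    and dist: "\<And>e. e \<in> E \<Longrightarrow> distributed M lborel (g e) std_normal_density"
    and sub: "subalgebra M D"
    and mf [measurable]: "\<And>e. e \<in> E \<Longrightarrow> (\<lambda>(\<omega>, \<sigma>). f e \<omega> \<sigma>) \<in> borel_measurable (D \<Otimes>\<^sub>M S)"
    and bf: "\<And>e \<omega> \<sigma>. e \<in> E \<Longrightarrow> \<omega> \<in> space M \<Longrightarrow> \<sigma> \<in> space S \<Longrightarrow> f e \<omega> \<sigma> \<in> {-1..1}"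
    and ker: "finite_nonzero_kernel D S \<mu>"
    and indepD: "M.indep_set (sets D)
      (sets (vimage_algebra (space M) (\<lambda>\<omega>. \<lambda>e\<in>E. g e \<omega>) (\<Pi>\<^sub>M e\<in>E. borel)))"
    using disorder by (auto simp: gibbs_disorder_def)
  have spD: "space D = space M" and idD [measurable]: "(\<lambda>\<omega>. \<omega>) \<in> M \<rightarrow>\<^sub>M D"
    using sub by (auto simp: subalgebra_def measurable_def)
  let ?B = "\<Pi>\<^sub>M e\<in>E. (borel :: real measure)"
  define x where "x \<omega> = (\<lambda>e\<in>E. g e \<omega>)" for \<omega>
  have mg [measurable]: "g e \<in> borel_measurable M" if "e \<in> E" for e
    using distributed_measurable[OF dist[OF that]] by simp
  have mx [measurable]: "x \<in> M \<rightarrow>\<^sub>M ?B"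
    unfolding x_def by measurable
  have distr_x: "distr M ?B x = gauss_prod E"
  proof -
    have "distr M ?B x = (\<Pi>\<^sub>M e\<in>E. distr M borel (g e))"
      using M.indep_vars_iff_distr_eq_PiM'[OF nonempty, where M' = "\<lambda>_. borel" and X = g] indep
      by (simp add: x_def[abs_def])
    also have "\<dots> = gauss_prod E"
    proof (rule PiM_cong[OF refl])
      fix e assume "e \<in> E"
      have "distr M borel (g e) = distr M lborel (g e)"
        by (rule distr_cong) simp_all
      then show "distr M borel (g e) = std_gauss"
        using distributed_distr_eq_density[OF dist[OF \<open>e \<in> E\<close>]] by simp
    qed
    finally show ?thesis .
  qed
  \<comment> \<open>\<open>P\<close> is the restriction of \<open>M\<close> to \<open>D\<close>, the
    law of the disorder in \<open>f\<close> and \<mu>.\<close>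
  define P where "P = distr M D (\<lambda>\<omega>. \<omega>)"
  interpret P: prob_space P
    unfolding P_def by (rule M.prob_space_distr) measurable
  have [measurable_cong]: "sets P = sets D" and spP: "space P = space M"
    unfolding P_def by (simp_all add: spD)
  interpret N: finite_product_prob_space "\<lambda>_. std_gauss" E
    by (rule finite_product_prob_space_gauss[OF E])
  interpret PN: pair_prob_space P "gauss_prod E" ..
  have joint: "distr M (D \<Otimes>\<^sub>M ?B) (\<lambda>\<omega>. (\<omega>, x \<omega>)) = P \<Otimes>\<^sub>M gauss_prod E"
    using M.distr_Pair_indep_set[OF sub mx] indepD unfolding P_def distr_x[symmetric] x_def[abs_def] by simp
  have sys: "gibbs_system (\<mu> \<omega>) E (\<lambda>e. f e \<omega>)" if \<omega>: "\<omega> \<in> space M" for \<omega>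
  proof -
    have k: "sets (\<mu> \<omega>) = sets S" "finite_measure (\<mu> \<omega>)" "emeasure (\<mu> \<omega>) (space S) \<noteq> 0"
      using ker \<omega> unfolding finite_nonzero_kernel_def spD by auto
    have sp: "space (\<mu> \<omega>) = space S"
      using sets_eq_imp_space_eq[OF k(1)] .
    interpret finite_measure "\<mu> \<omega>" by fact
    show ?thesis
    proof
      fix e assume e: "e \<in> E"
      have "(\<lambda>\<sigma>. case (\<omega>, \<sigma>) of (\<omega>, \<sigma>) \<Rightarrow> f e \<omega> \<sigma>) \<in> borel_measurable S"
        using \<omega> e by (intro measurable_compose[OF _ mf]) (simp_all add: spD)
      then show "f e \<omega> \<in> borel_measurable (\<mu> \<omega>)"
        by (simp cong: measurable_cong_sets add: k(1))
      show "\<bar>f e \<omega> \<sigma>\<bar> \<le> 1" if "\<sigma> \<in> space (\<mu> \<omega>)" for \<sigma>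
        using bf[OF e \<omega>, of \<sigma>] that by (simp add: sp abs_le_iff)
    qed (use k E sp in auto)
  qed
  define T where "T F \<omega> z = (\<integral>\<sigma>. F \<omega> \<sigma> * exp (\<gamma> * gauss_field E z (\<lambda>e. f e \<omega>) \<sigma>) \<partial>\<mu> \<omega>)"
    for F :: "'w \<Rightarrow> 's \<Rightarrow> real" and \<omega> and z :: "'e \<Rightarrow> real"
  have mT: "(\<lambda>(\<omega>, z). T F \<omega> z) \<in> borel_measurable (D \<Otimes>\<^sub>M ?B)"
    if [measurable]: "(\<lambda>(\<omega>, \<sigma>). F \<omega> \<sigma>) \<in> borel_measurable (D \<Otimes>\<^sub>M S)" for F
  proof -
    have "(\<lambda>(p, \<sigma>). F (fst p) \<sigma> * exp (\<gamma> * gauss_field E (snd p) (\<lambda>e. f e (fst p)) \<sigma>))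
        \<in> borel_measurable ((D \<Otimes>\<^sub>M ?B) \<Otimes>\<^sub>M S)"
      unfolding gauss_field_def by measurable
    from measurable_integral_finite_kernel[OF ker measurable_fst this] show ?thesis
      by (simp add: T_def split_beta')
  qed
  define A where "A \<omega> e z = T (f e) \<omega> z / T (\<lambda>_ _. 1) \<omega> z" for \<omega> e z
  define C where "C \<omega> e e' z = T (\<lambda>\<omega> \<sigma>. f e \<omega> \<sigma> * f e' \<omega> \<sigma>) \<omega> z / T (\<lambda>_ _. 1) \<omega> z
      - A \<omega> e z * A \<omega> e' z" for \<omega> e e' z
  have mA [measurable]: "(\<lambda>(\<omega>, z). A \<omega> e z) \<in> borel_measurable (D \<Otimes>\<^sub>M ?B)" if "e \<in> E" for e
  proof -
    have [measurable]: "(\<lambda>(\<omega>, z). T (f e) \<omega> z) \<in> borel_measurable (D \<Otimes>\<^sub>M ?B)"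
      "(\<lambda>(\<omega>, z). T (\<lambda>_ _. 1) \<omega> z) \<in> borel_measurable (D \<Otimes>\<^sub>M ?B)"
      using that by (intro mT; measurable)+
    show ?thesis
      unfolding A_def by measurable
  qed
  have mC [measurable]: "(\<lambda>(\<omega>, z). C \<omega> e e' z) \<in> borel_measurable (D \<Otimes>\<^sub>M ?B)"
    if [measurable]: "e \<in> E" "e' \<in> E" for e e'
  proof -
    have [measurable]: "(\<lambda>(\<omega>, z). T (\<lambda>\<omega> \<sigma>. f e \<omega> \<sigma> * f e' \<omega> \<sigma>) \<omega> z) \<in> borel_measurable (D \<Otimes>\<^sub>M ?B)"
      "(\<lambda>(\<omega>, z). T (\<lambda>_ _. 1) \<omega> z) \<in> borel_measurable (D \<Otimes>\<^sub>M ?B)"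
      by (intro mT; measurable)+
    show ?thesis
      unfolding C_def by measurable
  qed
  define V where "V \<omega> z = (\<Sum>e\<in>E. \<Sum>e'\<in>E. a e * a e' * z e * z e' * C \<omega> e e' z)" for \<omega> z
  have mV [measurable]: "(\<lambda>(\<omega>, z). V \<omega> z) \<in> borel_measurable (D \<Otimes>\<^sub>M ?B)"
    unfolding V_def by measurable
  define K where "K = (\<Sum>e\<in>E. \<Sum>e'\<in>E. 2 * \<bar>a e * a e'\<bar>)"
  have A_eq: "A \<omega> e z = (\<integral>\<sigma>. f e \<omega> \<sigma> \<partial>gibbs_measure (\<mu> \<omega>) (\<lambda>\<sigma>. \<gamma> * gauss_field E z (\<lambda>e. f e \<omega>) \<sigma>))"
    if "\<omega> \<in> space M" "e \<in> E" for \<omega> e z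
  proof -
    interpret gibbs_system "\<mu> \<omega>" E "\<lambda>e. f e \<omega>" \<gamma> by (rule sys[OF that(1)])
    show ?thesis
      using avg_eq[OF h_measurable[OF that(2)], of z] by (simp add: A_def T_def tilted_def)
  qed
  have C_eq: "C \<omega> e e' z = gibbs_system.cov (\<mu> \<omega>) E (\<lambda>e. f e \<omega>) \<gamma> e e' z"
    if "\<omega> \<in> space M" "e \<in> E" "e' \<in> E" for \<omega> e e' z
  proof -
    interpret gibbs_system "\<mu> \<omega>" E "\<lambda>e. f e \<omega>" \<gamma> by (rule sys[OF that(1)])
    have "(\<lambda>\<sigma>. f e \<omega> \<sigma> * f e' \<omega> \<sigma>) \<in> borel_measurable (\<mu> \<omega>)"
      using h_measurable that by measurable
    from avg_eq[OF this, of z] show ?thesis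
      unfolding cov_def by (simp add: C_def A_eq that T_def tilted_def)
  qed
  have bC: "\<bar>C \<omega> e e' z\<bar> \<le> 2" if "\<omega> \<in> space M" "e \<in> E" "e' \<in> E" for \<omega> e e' z
    using gibbs_system.abs_cov_le[OF sys[OF that(1)] that(2,3)] by (simp add: C_eq that)
  have w0: "0 \<le> weight E z" for z :: "'e \<Rightarrow> real"
    using weight_ge_1[of E z] by linarith
  \<comment> \<open>A crude growth bound that serves the integrability of the variance; the 2 in
    \<open>K\<close> comes from the bound on covariances.\<close>
  have bV: "\<bar>V \<omega> z\<bar> \<le> K * weight E z ^ 2" if \<omega>: "\<omega> \<in> space M" for \<omega> z
  proof -
    have "\<bar>V \<omega> z\<bar> \<le> (\<Sum>e\<in>E. \<Sum>e'\<in>E. \<bar>a e * a e' * z e * z e' * C \<omega> e e' z\<bar>)"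
      unfolding V_def by (intro order_trans[OF sum_abs] sum_mono order_refl)
    also have "\<dots> \<le> (\<Sum>e\<in>E. \<Sum>e'\<in>E. \<bar>a e\<bar> * \<bar>a e'\<bar> * weight E z * weight E z * 2)"
      unfolding abs_mult using \<omega>
      by (intro sum_mono mult_mono) (auto simp: abs_le_weight[OF E] bC w0)
    also have "\<dots> = K * weight E z ^ 2"
      unfolding K_def sum_distrib_right
      by (intro sum.cong refl) (simp add: abs_mult power2_eq_square mult_ac)
    finally show ?thesis .
  qed
  \<comment> \<open>The bound for frozen disorder is the same for every outcome, so averaging it
    over \<open>P\<close> later does not change it.\<close>
  have V_bound: "(\<integral>z. V \<omega> z \<partial>gauss_prod E) \<le> sqrt 2 / \<gamma> * L2_set a E * (\<Sum>e\<in>E. \<bar>a e\<bar>)"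
    if \<omega>: "\<omega> \<in> space M" for \<omega>
  proof -
    interpret gibbs_system "\<mu> \<omega>" E "\<lambda>e. f e \<omega>" \<gamma> by (rule sys[OF \<omega>])
    have sect: "(\<lambda>z. F \<omega> z) \<in> borel_measurable ?B"
      if "(\<lambda>(\<omega>, z). F \<omega> z) \<in> borel_measurable (D \<Otimes>\<^sub>M ?B)" for F :: "'w \<Rightarrow> ('e \<Rightarrow> real) \<Rightarrow> real"
      using measurable_compose[OF measurable_Pair1'[of \<omega> D ?B] that] \<omega> by (simp add: spD)
    show ?thesis
      unfolding V_def
    proof (rule gaussian_covariance_bound[OF E gamma, of "A \<omega>"])
      fix e assume e: "e \<in> E"
      show "A \<omega> e \<in> borel_measurable ?B"
        using sect[OF mA[OF e]] .
      show "\<bar>A \<omega> e z\<bar> \<le> 1" for z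
        unfolding A_eq[OF \<omega> e] using e by (intro abs_avg_le) (auto simp: h_bound)
      show "0 \<le> C \<omega> e e z" for z
        by (simp add: C_eq \<omega> e cov_self_nonneg)
      fix e' assume e': "e' \<in> E"
      show "C \<omega> e e' \<in> borel_measurable ?B"
        using sect[OF mC[OF e e']] .
      show "\<bar>C \<omega> e e' z\<bar> \<le> 2" for z
        by (rule bC[OF \<omega> e e'])
      show "((\<lambda>y. A \<omega> e' (z(e := y))) has_real_derivative \<gamma> * C \<omega> e e' (z(e := y))) (at y)" for z y
        using avg_deriv[OF e e', where x = z and y = y] by (simp add: C_eq A_eq \<omega> e e')
      show "isCont (\<lambda>y. C \<omega> e e' (z(e := y))) y" for z y
        using cov_isCont[OF e e', where x = z and y = y] by (simp add: C_eq \<omega> e e')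
    qed
  qed
  have var_eq: "(\<integral>\<sigma>. (W \<omega> \<sigma>)\<^sup>2 \<partial>G \<omega>) - (\<integral>\<sigma>. W \<omega> \<sigma> \<partial>G \<omega>)\<^sup>2 = V \<omega> (x \<omega>)"
    if \<omega>: "\<omega> \<in> space M" for \<omega>
  proof -
    interpret gibbs_system "\<mu> \<omega>" E "\<lambda>e. f e \<omega>" \<gamma> by (rule sys[OF \<omega>])
    have "Y \<omega> = gauss_field E (x \<omega>) (\<lambda>e. f e \<omega>)"
      "W \<omega> = gauss_field E (\<lambda>e. a e * x \<omega> e) (\<lambda>e. f e \<omega>)"
      unfolding Y_def W_def gauss_field_def x_def by (auto intro!: ext sum.cong)
    then show ?thesis
      using variance_gauss_field[where a = a and x = "x \<omega>"] by (simp add: G_def V_def C_eq \<omega>)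
  qed
  have mVx: "(\<lambda>\<omega>. V \<omega> (x \<omega>)) \<in> borel_measurable M"
    using measurable_compose[OF measurable_Pair[OF idD mx] mV] by simp
  have intM: "integrable M (\<lambda>\<omega>. V \<omega> (x \<omega>))"
  proof (rule Bochner_Integration.integrable_bound[OF _ mVx])
    have "integrable (gauss_prod E) (\<lambda>z. K * weight E z ^ 2)"
    proof (rule integrable_gauss_prod_growth[OF E])
      show "(\<lambda>z. K * weight E z ^ 2) \<in> borel_measurable ?B"
        unfolding weight_def by measurable
      show "\<bar>K * weight E z ^ 2\<bar> \<le> K * weight E z ^ 2" for z
        by (simp add: K_def sum_nonneg)
    qed
    then show "integrable M (\<lambda>\<omega>. K * weight E (x \<omega>) ^ 2)"
      unfolding distr_x[symmetric] by (rule integrable_distr[OF mx])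
    show "AE \<omega> in M. norm (V \<omega> (x \<omega>)) \<le> norm (K * weight E (x \<omega>) ^ 2)"
      using bV by (auto intro!: AE_I2 order_trans[OF bV])
  qed
  have mpair: "(\<lambda>\<omega>. (\<omega>, x \<omega>)) \<in> M \<rightarrow>\<^sub>M D \<Otimes>\<^sub>M ?B"
    by measurable
  have intJ: "integrable (P \<Otimes>\<^sub>M gauss_prod E) (\<lambda>(\<omega>, z). V \<omega> z)"
    unfolding joint[symmetric] using intM by (simp add: integrable_distr_eq[OF mpair mV])
  \<comment> \<open>Independence is used here through \<open>joint\<close>: the expectation becomes
    an integral over a product measure, where Fubini integrates the Gaussian vector first with the
    disorder held fixed.\<close>
  have "(\<integral>\<omega>. V \<omega> (x \<omega>) \<partial>M) = (\<integral>(\<omega>, z). V \<omega> z \<partial>(P \<Otimes>\<^sub>M gauss_prod E))"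
    unfolding joint[symmetric] by (simp add: integral_distr[OF mpair mV])
  also have "\<dots> = (\<integral>\<omega>. (\<integral>z. V \<omega> z \<partial>gauss_prod E) \<partial>P)"
    using PN.integral_fst'[OF intJ] by simp
  also have "\<dots> \<le> (\<integral>\<omega>. sqrt 2 / \<gamma> * L2_set a E * (\<Sum>e\<in>E. \<bar>a e\<bar>) \<partial>P)"
    using PN.integrable_fst'[OF intJ] V_bound by (intro integral_mono) (auto simp: spP)
  also have "\<dots> = sqrt 2 / \<gamma> * L2_set a E * (\<Sum>e\<in>E. \<bar>a e\<bar>)"
    using P.prob_space by simp
  finally have "(\<integral>\<omega>. V \<omega> (x \<omega>) \<partial>M) \<le> sqrt 2 / \<gamma> * L2_set a E * (\<Sum>e\<in>E. \<bar>a e\<bar>)" .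
  then show ?thesis
    using intM by (simp add: var_eq cong: Bochner_Integration.integrable_cong Bochner_Integration.integral_cong)
qed

end
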